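(* An infinite bitstring $X$ is Schnorr random if and only if for every computable measure machine $C$ and every $d$, there is $n_0$ such that $K_C(X\upharpoonright n)>n+d$ for all $n\ge n_0$.
   Context: A computable measure machine is a prefix-free Turing machine $C$ whose domain $\operatorname{dom}(C)\subseteq\{0,1\}^*$ has computable Lebesgue measure $\sum_{\pi\in\operatorname{dom}(C)}2^{-|\pi|}$. For such $C$ and a finite string $\sigma$, $K_C(\sigma)=\inf\{|\pi|:C(\pi)=\sigma\}$, with $\inf\emptyset=\infty$. $X\upharpoonright n$ denotes the first $n$ bits of $X$. $X$ is Schnorr random (in the usual classical sense) if $X$ passes every Schnorr test, where a Schnorr test is a computable sequence $(S^m)_m$ of clopen subsets of Cantor space, each given by a finite set of strings, such that $\sum_m\mu(S^m)$ is a computable real ($\mu$ the uniform Lebesgue measure), and $X$ passes it if $X\in S^m$ for only finitely many $m$. *)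

theory Defs
  imports "HOL-Probability.Probability" "HOL-Library.Extended_Nat"
begin

datatype recf =
    Zero
  | Succ
  | Proj nat
  | Comp recf "recf list"
  | Prim recf recf
  | Mini recf

inductive eval :: "recf \<Rightarrow> nat list \<Rightarrow> nat \<Rightarrow> bool" where
  eval_Zero: "eval Zero xs 0"
| eval_Succ: "eval Succ (x # xs) (Suc x)"
| eval_Proj: "i < length xs \<Longrightarrow> eval (Proj i) xs (xs ! i)"
| eval_Comp: "list_all2 (\<lambda>g y. eval g xs y) gs ys \<Longrightarrow> eval f ys y \<Longrightarrow> eval (Comp f gs) xs y"
| eval_Prim0: "eval f xs y \<Longrightarrow> eval (Prim f g) (0 # xs) y"
| eval_PrimS: "eval (Prim f g) (n # xs) r \<Longrightarrow> eval g (n # r # xs) y \<Longrightarrow> eval (Prim f g) (Suc n # xs) y"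
| eval_Mini: "eval f (n # xs) 0 \<Longrightarrow> (\<forall>m<n. \<exists>y. eval f (m # xs) y \<and> y \<noteq> 0) \<Longrightarrow> eval (Mini f) xs n"

definition partial_computable :: "(nat \<Rightarrow> nat option) \<Rightarrow> bool" where
  "partial_computable g \<longleftrightarrow> (\<exists>f. \<forall>n y. eval f [n] y \<longleftrightarrow> g n = Some y)"

definition total_computable :: "(nat \<Rightarrow> nat) \<Rightarrow> bool" where
  "total_computable h \<longleftrightarrow> partial_computable (\<lambda>n. Some (h n))"

section \<open>Coding of finite bit strings by natural numbers (bijective)\<close>

fun enc :: "bool list \<Rightarrow> nat" where
  "enc [] = 0"
| "enc (b # bs) = 2 * enc bs + (if b then 2 else 1)"

definition computable_real :: "real \<Rightarrow> bool" where
  "computable_real x \<longleftrightarrow> (\<exists>a b. total_computable a \<and> total_computable b \<and>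
     (\<forall>n. \<bar>x - (real (a n) - real (b n)) / 2 ^ n\<bar> \<le> 1 / 2 ^ n))"

definition prefix_free :: "bool list set \<Rightarrow> bool" where
  "prefix_free A \<longleftrightarrow> (\<forall>p\<in>A. \<forall>q\<in>A. prefix p q \<longrightarrow> p = q)"

definition partial_computable_string_fun :: "(bool list \<Rightarrow> bool list option) \<Rightarrow> bool" where
  "partial_computable_string_fun C \<longleftrightarrow>
     (\<exists>g. partial_computable g \<and> (\<forall>p. g (enc p) = map_option enc (C p)))"

definition domain_measure :: "(bool list \<Rightarrow> bool list option) \<Rightarrow> real" where
  "domain_measure C = (\<Sum>\<^sub>\<infinity>p\<in>dom C. (1/2) ^ length p)"

definition computable_measure_machine :: "(bool list \<Rightarrow> bool list option) \<Rightarrow> bool" where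
  "computable_measure_machine C \<longleftrightarrow>
     partial_computable_string_fun C \<and> prefix_free (dom C) \<and> computable_real (domain_measure C)"

definition K :: "(bool list \<Rightarrow> bool list option) \<Rightarrow> bool list \<Rightarrow> enat" where
  "K C \<sigma> = Inf ((\<lambda>p. enat (length p)) ` {p. C p = Some \<sigma>})"

definition init_seg :: "(nat \<Rightarrow> bool) \<Rightarrow> nat \<Rightarrow> bool list" where
  "init_seg X n = map X [0..<n]"

definition cantor_measure :: "(nat \<Rightarrow> bool) measure" where
  "cantor_measure = (\<Pi>\<^sub>M i\<in>(UNIV::nat set). measure_pmf (bernoulli_pmf (1/2)))"

text \<open>The finite set of strings with canonical index k.\<close>
definition canon :: "nat \<Rightarrow> bool list set" where
  "canon k = {\<sigma>. odd (k div 2 ^ enc \<sigma>)}"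

definition cyl :: "bool list set \<Rightarrow> (nat \<Rightarrow> bool) set" where
  "cyl S = {X. \<exists>\<sigma>\<in>S. init_seg X (length \<sigma>) = \<sigma>}"

definition schnorr_test :: "(nat \<Rightarrow> nat) \<Rightarrow> bool" where
  "schnorr_test h \<longleftrightarrow> total_computable h \<and>
     summable (\<lambda>m. measure cantor_measure (cyl (canon (h m)))) \<and>
     computable_real (\<Sum>m. measure cantor_measure (cyl (canon (h m))))"

definition passes :: "(nat \<Rightarrow> bool) \<Rightarrow> (nat \<Rightarrow> nat) \<Rightarrow> bool" where
  "passes X h \<longleftrightarrow> finite {m. X \<in> cyl (canon (h m))}"

definition schnorr_random :: "(nat \<Rightarrow> bool) \<Rightarrow> bool" where
  "schnorr_random X \<longleftrightarrow> (\<forall>h. schnorr_test h \<longrightarrow> passes X h)"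

end

theory Submission
  imports Defs
begin

text \<open>If \<open>C\<close> compresses infinitely many prefixes of \<open>X\<close> to within \<open>d\<close> bits, enumerate its domain and
  let \<open>p\<close> contribute the cylinder of \<open>C p\<close> whenever \<open>length p \<le> length (C p) + d\<close>. The total measure
  is at most \<open>2 ^ d\<close> times that of the domain, tail by tail, so computability of the latter
  gives computability of the former.

  Conversely, given a test, replace its \<open>m\<close>-th component by strings of a single length \<open>L m\<close> with
  \<open>L\<close> strictly increasing, and assign to these strings, in order, adjacent dyadic intervals of
  size \<open>2 ^ - (L m + d)\<close>, where \<open>2 ^ d\<close> bounds the total measure of the test. The resulting machine
  has a decidable domain of measure \<open>2 ^ - d\<close> times that of the test.\<close>

text \<open>Violating the bound means \<open>K C (init_seg X n) \<le> n + d\<close> for infinitely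
  many \<open>n\<close>, so a description may even be \<open>d\<close> bits longer than its string.
  This slack links the two notions: a cylinder has measure at most \<open>2 ^ d\<close> times the
  weight of its description, and conversely a test of total measure above 1 can be scaled down into
  the unit interval at a cost of \<open>d\<close> bits per description.

  The obstacle in the first direction is that a test is a total computable function, while a domain
  is only enumerated. Components are therefore indexed by a program paired with the stage at which
  it halts: correctness of a pair is decidable, and wrong pairs get the empty set, which leaves the
  sum of the measures unchanged. In the second direction the strings of a component may overlap and
  differ in length; passing to one length makes cylinders disjoint and turns the measure into a
  count. Strict growth of \<open>L\<close> also makes infinitely many failed components yield
  infinitely many \<open>n\<close>.\<close>

section \<open>Computable functions of an environment\<close>

text \<open>The \<open>k\<close> arguments are passed as an environment, of which only the entries below \<open>k\<close>
  matter. A bounded variable is then introduced by shifting the environment, so closure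
  properties apply as introduction rules up to beta reduction.\<close>

definition rec_fn :: "nat \<Rightarrow> ((nat \<Rightarrow> nat) \<Rightarrow> nat) \<Rightarrow> bool" where
  "rec_fn k F \<longleftrightarrow> (\<exists>f. \<forall>xs. length xs = k \<longrightarrow> eval f xs (F ((!) xs)))"

definition dec_pred :: "nat \<Rightarrow> ((nat \<Rightarrow> nat) \<Rightarrow> bool) \<Rightarrow> bool" where
  "dec_pred k P \<longleftrightarrow> rec_fn k (\<lambda>e. if P e then 1 else 0)"

lemma rec_fn_proj: "i < k \<Longrightarrow> rec_fn k (\<lambda>e. e i)"
  unfolding rec_fn_def by (metis eval_Proj)

lemma rec_fn_comp:
  assumes F: "rec_fn (length Gs) F" and Gs: "\<And>G. G \<in> set Gs \<Longrightarrow> rec_fn k G"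
  shows "rec_fn k (\<lambda>e. F ((!) (map (\<lambda>G. G e) Gs)))"
proof -
  obtain f where f: "\<And>xs. length xs = length Gs \<Longrightarrow> eval f xs (F ((!) xs))"
    using F unfolding rec_fn_def by blast
  have "\<forall>G\<in>set Gs. \<exists>g. \<forall>xs. length xs = k \<longrightarrow> eval g xs (G ((!) xs))"
    using Gs unfolding rec_fn_def by blast
  then obtain c where c: "\<And>G xs. G \<in> set Gs \<Longrightarrow> length xs = k \<Longrightarrow> eval (c G) xs (G ((!) xs))"
    by metis
  have "eval (Comp f (map c Gs)) xs (F ((!) (map (\<lambda>G. G ((!) xs)) Gs)))" if "length xs = k" for xs
    using that c by (intro eval_Comp[where ys = "map (\<lambda>G. G ((!) xs)) Gs"] f)
      (auto simp: list_all2_conv_all_nth)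
  then show ?thesis unfolding rec_fn_def by blast
qed

lemma rec_fn_comp1:
  "rec_fn 1 (\<lambda>e. f (e 0)) \<Longrightarrow> rec_fn k F \<Longrightarrow> rec_fn k (\<lambda>e. f (F e))"
  using rec_fn_comp[of "[F]" "\<lambda>e. f (e 0)" k] by simp

lemma rec_fn_comp2:
  "rec_fn 2 (\<lambda>e. f (e 0) (e 1)) \<Longrightarrow> rec_fn k F \<Longrightarrow> rec_fn k G \<Longrightarrow> rec_fn k (\<lambda>e. f (F e) (G e))"
  using rec_fn_comp[of "[F, G]" "\<lambda>e. f (e 0) (e 1)" k] by (auto simp: numeral_2_eq_2)

lemma dec_pred_comp1:
  "dec_pred 1 (\<lambda>e. P (e 0)) \<Longrightarrow> rec_fn k F \<Longrightarrow> dec_pred k (\<lambda>e. P (F e))"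
  unfolding dec_pred_def by (rule rec_fn_comp1)

lemma dec_pred_comp2:
  "dec_pred 2 (\<lambda>e. P (e 0) (e 1)) \<Longrightarrow> rec_fn k F \<Longrightarrow> rec_fn k G \<Longrightarrow> dec_pred k (\<lambda>e. P (F e) (G e))"
  unfolding dec_pred_def by (rule rec_fn_comp2)

lemma rec_fn_Suc: "rec_fn k F \<Longrightarrow> rec_fn k (\<lambda>e. Suc (F e))"
proof -
  have "rec_fn 1 (\<lambda>e. Suc (e 0))"
    unfolding rec_fn_def
    by (rule exI[of _ Succ]) (auto simp: length_Suc_conv intro: eval_Succ)
  then show "rec_fn k F \<Longrightarrow> rec_fn k (\<lambda>e. Suc (F e))" by (rule rec_fn_comp1)
qed

lemma rec_fn_0: "rec_fn k (\<lambda>e. 0)"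
  unfolding rec_fn_def by (meson eval_Zero)

lemma rec_fn_const: "rec_fn k (\<lambda>e. c)"
  by (induction c) (auto intro: rec_fn_Suc rec_fn_0)

lemma rec_fn_rec_nat:
  assumes B: "rec_fn k B" and F: "rec_fn k F"
    and G: "rec_fn (Suc (Suc k)) (\<lambda>e. G (e 0) (e 1) (\<lambda>i. e (Suc (Suc i))))"
  shows "rec_fn k (\<lambda>e. rec_nat (F e) (\<lambda>n r. G n r e) (B e))"
proof -
  obtain f where f: "\<And>xs. length xs = k \<Longrightarrow> eval f xs (F ((!) xs))"
    using F unfolding rec_fn_def by blast
  obtain g where "\<And>xs. length xs = Suc (Suc k) \<Longrightarrow>
      eval g xs (G (xs ! 0) (xs ! 1) (\<lambda>i. xs ! Suc (Suc i)))"
    using G unfolding rec_fn_def by blast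
  from this[of "_ # _ # _"] have g: "\<And>xs n r. length xs = k \<Longrightarrow> eval g (n # r # xs) (G n r ((!) xs))"
    by simp
  have P: "eval (Prim f g) (n # xs) (rec_nat (F ((!) xs)) (\<lambda>n r. G n r ((!) xs)) n)"
    if "length xs = k" for n xs
    by (induction n) (auto intro: eval_Prim0 eval_PrimS f g that)
  let ?H = "\<lambda>e. rec_nat (F (\<lambda>i. e (Suc i))) (\<lambda>n r. G n r (\<lambda>i. e (Suc i))) (e 0)"
  have H: "rec_fn (Suc k) ?H"
    unfolding rec_fn_def
  proof (intro exI[of _ "Prim f g"] allI impI)
    fix xs :: "nat list" assume "length xs = Suc k"
    then obtain n ys where "xs = n # ys" "length ys = k" by (auto simp: length_Suc_conv)
    with P[of ys n] show "eval (Prim f g) xs (?H ((!) xs))" by simp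
  qed
  \<comment> \<open>\<open>Prim\<close> recurses on its first argument; prepending the value of
    \<open>B\<close> to the unchanged environment supplies the bound.\<close>
  let ?Gs = "B # map (\<lambda>i e. e i) [0..<k]"
  have "rec_fn k (\<lambda>e. ?H ((!) (map (\<lambda>G. G e) ?Gs)))"
    by (rule rec_fn_comp) (use H B in \<open>auto intro: rec_fn_proj\<close>)
  then obtain h where h: "\<And>xs. length xs = k \<Longrightarrow> eval h xs (?H ((!) (map (\<lambda>G. G ((!) xs)) ?Gs)))"
    unfolding rec_fn_def by blast
  have "map (\<lambda>G. G ((!) xs)) ?Gs = B ((!) xs) # xs" if "length xs = k" for xs
    using that by (auto simp: o_def intro: map_nth)
  with h show ?thesis unfolding rec_fn_def by (intro exI[of _ h]) auto
qed

lemma rec_fn_add: assumes "rec_fn k F" "rec_fn k G" shows "rec_fn k (\<lambda>e. F e + G e)"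
proof -
  have "rec_fn k (\<lambda>e. rec_nat (F e) (\<lambda>n r. Suc r) (G e))"
    by (intro rec_fn_rec_nat assms rec_fn_Suc rec_fn_proj) auto
  moreover have "rec_nat a (\<lambda>n r. Suc r) b = a + b" for a b :: nat by (induction b) auto
  ultimately show ?thesis by simp
qed

lemma rec_fn_sum:
  assumes "rec_fn k B" "rec_fn (Suc k) (\<lambda>e. F (e 0) (\<lambda>i. e (Suc i)))"
  shows "rec_fn k (\<lambda>e. \<Sum>i<B e. F i e)"
proof -
  \<comment> \<open>Skips entry 1, the accumulator: \<open>F\<close> expects only the index in front
    of the environment, while a step function of \<open>rec_nat\<close> has both.\<close>
  let ?Gs = "(\<lambda>e. e 0) # map (\<lambda>i e. e (Suc (Suc i))) [0..<k]"
  have "rec_fn (Suc (Suc k)) (\<lambda>e. (\<lambda>e. F (e 0) (\<lambda>i. e (Suc i))) ((!) (map (\<lambda>G. G e) ?Gs)))"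
    by (rule rec_fn_comp) (use assms(2) in \<open>auto intro: rec_fn_proj\<close>)
  then obtain h where h: "\<And>xs. length xs = Suc (Suc k) \<Longrightarrow>
      eval h xs ((\<lambda>e. F (e 0) (\<lambda>i. e (Suc i))) ((!) (map (\<lambda>G. G ((!) xs)) ?Gs)))"
    unfolding rec_fn_def by blast
  have h': "eval h (n # r # xs) (F n ((!) xs))" if "length xs = k" for n r xs
  proof -
    have "map (\<lambda>G. G ((!) (n # r # xs))) ?Gs = n # xs"
      using that by (auto simp: o_def intro: map_nth)
    with h[of "n # r # xs"] that show ?thesis by simp
  qed
  have "rec_fn (Suc (Suc k)) (\<lambda>e. F (e 0) (\<lambda>i. e (Suc (Suc i))))"
    unfolding rec_fn_def
  proof (intro exI[of _ h] allI impI)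
    fix xs :: "nat list" assume "length xs = Suc (Suc k)"
    then obtain n r ys where "xs = n # r # ys" "length ys = k" by (auto simp: length_Suc_conv)
    with h' show "eval h xs (F (xs ! 0) (\<lambda>i. xs ! Suc (Suc i)))" by simp
  qed
  then have "rec_fn k (\<lambda>e. rec_nat 0 (\<lambda>n r. r + F n e) (B e))"
    by (intro rec_fn_rec_nat assms rec_fn_const rec_fn_add rec_fn_proj) auto
  moreover have "rec_nat 0 (\<lambda>n r. r + F n e) b = (\<Sum>i<b. F i e)" for e b by (induction b) auto
  ultimately show ?thesis by simp
qed

lemma rec_fn_pred: assumes "rec_fn k F" shows "rec_fn k (\<lambda>e. F e - 1)"
proof -
  have "rec_fn k (\<lambda>e. rec_nat 0 (\<lambda>n r. n) (F e))"
    by (intro rec_fn_rec_nat assms rec_fn_proj rec_fn_const) auto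
  moreover have "rec_nat 0 (\<lambda>n r. n) a = a - 1" for a by (cases a) auto
  ultimately show ?thesis by simp
qed

lemma rec_fn_diff: assumes "rec_fn k F" "rec_fn k G" shows "rec_fn k (\<lambda>e. F e - G e)"
proof -
  have "rec_fn k (\<lambda>e. rec_nat (F e) (\<lambda>n r. r - 1) (G e))"
    by (intro rec_fn_rec_nat assms rec_fn_pred rec_fn_proj) auto
  moreover have "rec_nat a (\<lambda>n r. r - 1) b = a - b" for a b :: nat by (induction b) auto
  ultimately show ?thesis by simp
qed

text \<open>The recursion runs on two projections and the general case follows by composition;
  otherwise \<open>F\<close> would occur in the step function and would have to be lifted to an
  environment with two more entries.\<close>

lemma rec_fn_mult: assumes "rec_fn k F" "rec_fn k G" shows "rec_fn k (\<lambda>e. F e * G e)"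
proof -
  have "rec_fn 2 (\<lambda>e. rec_nat 0 (\<lambda>n r. r + e 0) (e 1))"
    by (intro rec_fn_rec_nat rec_fn_proj rec_fn_const rec_fn_add) auto
  moreover have "rec_nat 0 (\<lambda>n r. r + a) b = a * b" for a b :: nat by (induction b) auto
  ultimately have "rec_fn 2 (\<lambda>e. e 0 * e 1)" by simp
  from rec_fn_comp2[OF this assms] show ?thesis .
qed

lemma rec_fn_power: assumes "rec_fn k F" "rec_fn k G" shows "rec_fn k (\<lambda>e. F e ^ G e)"
proof -
  have "rec_fn 2 (\<lambda>e. rec_nat 1 (\<lambda>n r. r * e 0) (e 1))"
    by (intro rec_fn_rec_nat rec_fn_proj rec_fn_const rec_fn_mult) auto
  moreover have "rec_nat 1 (\<lambda>n r. r * a) b = a ^ b" for a b :: nat by (induction b) auto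
  ultimately have "rec_fn 2 (\<lambda>e. e 0 ^ e 1)" by simp
  from rec_fn_comp2[OF this assms] show ?thesis .
qed

lemma rec_fn_if:
  assumes "dec_pred k P" "rec_fn k F" "rec_fn k G"
  shows "rec_fn k (\<lambda>e. if P e then F e else G e)"
proof -
  have "rec_fn k (\<lambda>e. (if P e then 1 else 0) * F e + (1 - (if P e then 1 else 0)) * G e)"
    using assms unfolding dec_pred_def
    by (intro rec_fn_add rec_fn_mult rec_fn_diff rec_fn_const)
  moreover have "(if p then 1 else 0) * a + (1 - (if p then 1 else 0)) * b = (if p then a else b)"
    for p and a b :: nat by simp
  ultimately show ?thesis by simp
qed

lemma dec_pred_le: assumes "rec_fn k F" "rec_fn k G" shows "dec_pred k (\<lambda>e. F e \<le> G e)"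
proof -
  have "rec_fn k (\<lambda>e. 1 - (F e - G e))" by (intro rec_fn_diff rec_fn_const assms)
  moreover have "1 - (a - b) = (if a \<le> b then 1 else 0)" for a b :: nat by auto
  ultimately show ?thesis by (simp add: dec_pred_def)
qed

lemma dec_pred_not: assumes "dec_pred k P" shows "dec_pred k (\<lambda>e. \<not> P e)"
proof -
  have "rec_fn k (\<lambda>e. 1 - (if P e then 1 else 0))"
    using assms by (intro rec_fn_diff rec_fn_const) (simp add: dec_pred_def)
  moreover have "1 - (if p then 1 else 0) = (if \<not> p then 1 else (0::nat))" for p by auto
  ultimately show ?thesis by (simp add: dec_pred_def)
qed

lemma dec_pred_conj: assumes "dec_pred k P" "dec_pred k Q" shows "dec_pred k (\<lambda>e. P e \<and> Q e)"
proof -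
  have "rec_fn k (\<lambda>e. (if P e then 1 else 0) * (if Q e then 1 else 0))"
    using assms unfolding dec_pred_def by (intro rec_fn_mult)
  moreover have "(if p then 1 else 0) * (if q then 1 else 0) = (if p \<and> q then 1 else (0::nat))"
    for p q by auto
  ultimately show ?thesis by (simp add: dec_pred_def)
qed

lemma dec_pred_less: "rec_fn k F \<Longrightarrow> rec_fn k G \<Longrightarrow> dec_pred k (\<lambda>e. F e < G e)"
  using dec_pred_not[OF dec_pred_le, of k G F] by (simp add: not_le)

lemma dec_pred_eq: "rec_fn k F \<Longrightarrow> rec_fn k G \<Longrightarrow> dec_pred k (\<lambda>e. F e = G e)"
  using dec_pred_conj[OF dec_pred_le dec_pred_le, of k F G G F]
  by (simp add: eq_iff)

lemma dec_pred_ex: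
  assumes "rec_fn k B" "dec_pred (Suc k) (\<lambda>e. P (e 0) (\<lambda>i. e (Suc i)))"
  shows "dec_pred k (\<lambda>e. \<exists>i<B e. P i e)"
proof -
  have "dec_pred k (\<lambda>e. 0 < (\<Sum>i<B e. if P i e then 1 else (0::nat)))"
    by (intro dec_pred_less rec_fn_const rec_fn_sum assms(1) assms(2)[unfolded dec_pred_def])
  moreover have "0 < (\<Sum>i<b. if P i e then 1 else (0::nat)) \<longleftrightarrow> (\<exists>i<b. P i e)" for b e
    by (auto simp: sum_eq_0_iff simp flip: neq0_conv)
  ultimately show ?thesis by simp
qed

lemma dec_pred_all:
  assumes "rec_fn k B" "dec_pred (Suc k) (\<lambda>e. P (e 0) (\<lambda>i. e (Suc i)))"
  shows "dec_pred k (\<lambda>e. \<forall>i<B e. P i e)"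
proof -
  have "dec_pred k (\<lambda>e. \<not> (\<exists>i<B e. \<not> P i e))"
    by (intro dec_pred_not dec_pred_ex assms)
  then show ?thesis by simp
qed

lemma rec_fn_div:
  assumes "rec_fn k F" "rec_fn k G" shows "rec_fn k (\<lambda>e. F e div G e)"
proof -
  \<comment> \<open>The quotient counts the positive multiples of \<open>b\<close> up to
    \<open>a\<close>, and it never exceeds \<open>a\<close>. For \<open>b = 0\<close> the count
    would be \<open>a\<close>, whereas \<open>a div 0 = 0\<close>.\<close>
  have eq: "a div b = (if b = 0 then 0 else \<Sum>q<a. if Suc q * b \<le> a then 1 else 0)" for a b :: nat
  proof (cases "b = 0")
    case False
    then have "Suc q * b \<le> a \<longleftrightarrow> q < a div b" for q
      by (metis Suc_le_eq less_eq_div_iff_mult_less_eq neq0_conv)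
    then have "(\<Sum>q<a. if Suc q * b \<le> a then 1 else 0) = card ({..<a} \<inter> {..<a div b})"
      by (simp add: sum.If_cases lessThan_def del: mult_Suc)
    also have "{..<a} \<inter> {..<a div b} = {..<a div b}"
      using div_le_dividend[of a b] by (intro Int_absorb1) (simp add: lessThan_subset_iff)
    finally show ?thesis using False by simp
  qed auto
  have "rec_fn 2 (\<lambda>e. if e 1 = 0 then 0 else \<Sum>q<e 0. if Suc q * e 1 \<le> e 0 then 1 else 0)"
    by (intro rec_fn_if dec_pred_eq dec_pred_le rec_fn_sum rec_fn_mult rec_fn_Suc rec_fn_const rec_fn_proj) auto
  then have "rec_fn 2 (\<lambda>e. e 0 div e 1)" unfolding eq[symmetric] .
  from rec_fn_comp2[OF this assms] show ?thesis .
qed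

lemma rec_fn_mod:
  assumes "rec_fn k F" "rec_fn k G" shows "rec_fn k (\<lambda>e. F e mod G e)"
  unfolding modulo_nat_def by (intro rec_fn_diff rec_fn_mult rec_fn_div assms)

lemma dec_pred_odd: "rec_fn k F \<Longrightarrow> dec_pred k (\<lambda>e. odd (F e))"
  unfolding odd_iff_mod_2_eq_one by (intro dec_pred_eq rec_fn_mod rec_fn_const)

lemmas rec_intros = rec_fn_const rec_fn_Suc rec_fn_add rec_fn_diff rec_fn_mult rec_fn_power
  rec_fn_div rec_fn_mod rec_fn_if rec_fn_sum dec_pred_le dec_pred_less dec_pred_eq dec_pred_not
  dec_pred_conj dec_pred_ex dec_pred_all dec_pred_odd rec_fn_proj

lemma rec_fn_Least:
  assumes P: "dec_pred (Suc k) (\<lambda>e. P (e 0) (\<lambda>i. e (Suc i)))" and ex: "\<And>e. \<exists>n. P n e"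
  shows "rec_fn k (\<lambda>e. LEAST n. P n e)"
proof -
  have "rec_fn (Suc k) (\<lambda>e. if P (e 0) (\<lambda>i. e (Suc i)) then 0 else 1)"
    by (intro rec_intros P)
  then obtain f where "\<And>xs. length xs = Suc k \<Longrightarrow>
      eval f xs (if P (xs ! 0) (\<lambda>i. xs ! Suc i) then 0 else 1)"
    unfolding rec_fn_def by blast
  from this[of "_ # _"]
  have f: "\<And>xs n. length xs = k \<Longrightarrow> eval f (n # xs) (if P n ((!) xs) then 0 else 1)" by simp
  have "eval (Mini f) xs (LEAST n. P n ((!) xs))" if "length xs = k" for xs
  proof (rule eval_Mini)
    show "eval f ((LEAST n. P n ((!) xs)) # xs) 0"
      using f[OF that, of "LEAST n. P n ((!) xs)"] LeastI_ex[OF ex, of "(!) xs"] by simp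
    show "\<forall>m<LEAST n. P n ((!) xs). \<exists>y. eval f (m # xs) y \<and> y \<noteq> 0"
      using f[OF that] not_less_Least by (metis zero_neq_one)
  qed
  then show ?thesis unfolding rec_fn_def by blast
qed

section \<open>Step-bounded evaluation\<close>

text \<open>The result is \<open>Suc y\<close> if the computation ends with value \<open>y\<close> when every unbounded search
  is cut off at \<open>s\<close>, and \<open>0\<close> if it is undefined or cut off.\<close>

fun step_eval :: "recf \<Rightarrow> nat \<Rightarrow> nat list \<Rightarrow> nat" where
  "step_eval Zero s xs = 1"
| "step_eval Succ s xs = (if xs = [] then 0 else Suc (Suc (xs ! 0)))"
| "step_eval (Proj i) s xs = (if i < length xs then Suc (xs ! i) else 0)"
| "step_eval (Comp f gs) s xs =
    (if \<exists>g\<in>set gs. step_eval g s xs = 0 then 0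
     else step_eval f s (map (\<lambda>g. step_eval g s xs - 1) gs))"
| "step_eval (Prim f g) s xs = (if xs = [] then 0
     else rec_nat (step_eval f s (tl xs))
       (\<lambda>n r. if r = 0 then 0 else step_eval g s (n # (r - 1) # tl xs)) (xs ! 0))"
| "step_eval (Mini f) s xs =
    (\<Sum>n<s. if step_eval f s (n # xs) = 1 \<and> (\<forall>m<n. 1 < step_eval f s (m # xs)) then Suc n else 0)"

lemma step_eval_Prim_Cons:
  "step_eval (Prim f g) s (n # xs) = rec_nat (step_eval f s xs)
       (\<lambda>n r. if r = 0 then 0 else step_eval g s (n # (r - 1) # xs)) n"
  unfolding step_eval.simps list.sel by simp

text \<open>At most one \<open>n\<close> meets the condition, so the sum that stands for the search
  has at most one nonzero term. The bounded sum is what lets the closure rules apply to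
  \<open>step_eval\<close>.\<close>

lemma step_eval_Mini_iff:
  "step_eval (Mini f) s xs = Suc n \<longleftrightarrow>
    n < s \<and> step_eval f s (n # xs) = 1 \<and> (\<forall>m<n. 1 < step_eval f s (m # xs))"
proof -
  let ?P = "\<lambda>n. step_eval f s (n # xs) = 1 \<and> (\<forall>m<n. 1 < step_eval f s (m # xs))"
  have uniq: "i = j" if "?P i" "?P j" for i j
    using that by (metis less_irrefl nat_neq_iff)
  have val: "step_eval (Mini f) s xs = Suc i" if "i < s" "?P i" for i
  proof -
    have "step_eval (Mini f) s xs = (\<Sum>n<s. if n = i then Suc i else 0)"
      unfolding step_eval.simps using that uniq by (intro sum.cong) metis+
    then show ?thesis using that by simp
  qed
  show ?thesis
  proof
    assume L: "step_eval (Mini f) s xs = Suc n"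
    have "\<exists>i<s. ?P i"
    proof (rule ccontr)
      assume "\<not> ?thesis"
      then have "step_eval (Mini f) s xs = 0" unfolding step_eval.simps by (intro sum.neutral) auto
      with L show False by simp
    qed
    then obtain i where "i < s" "?P i" by blast
    with val[of i] L show "n < s \<and> ?P n" by auto
  qed (use val in blast)
qed

text \<open>The cutoff acts only in \<open>Mini\<close>, where every smaller argument must already
  have a positive value. With \<open>\<noteq> 1\<close> instead of \<open>1 <\<close>, an argument
  undefined at stage \<open>s\<close> could turn into a smaller zero at stage \<open>t\<close> and
  change the result.\<close>

lemma step_eval_mono:
  "step_eval f s xs = Suc y \<Longrightarrow> s \<le> t \<Longrightarrow> step_eval f t xs = Suc y"
proof (induction f arbitrary: xs y)
  case (Comp f gs)
  have g: "step_eval g t xs = step_eval g s xs" if "g \<in> set gs" for g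
    using Comp.prems Comp.IH(2)[OF that, of xs "step_eval g s xs - 1"] that
    by (auto split: if_splits)
  then show ?case using Comp by (auto split: if_splits cong: map_cong)
next
  case (Prim f g)
  let ?R = "\<lambda>s. rec_nat (step_eval f s (tl xs))
       (\<lambda>n r. if r = 0 then 0 else step_eval g s (n # (r - 1) # tl xs))"
  have "?R s n = Suc z \<Longrightarrow> ?R t n = Suc z" for n z
  proof (induction n arbitrary: z)
    case 0 then show ?case using Prim by simp
  next
    case (Suc n)
    then obtain r where r: "?R s n = Suc r" by (cases "?R s n") auto
    with Suc.IH have "?R t n = Suc r" by blast
    then show ?case using Suc.prems r Prim.IH(2) \<open>s \<le> t\<close> by simp
  qed
  then show ?case using Prim.prems by (auto split: if_splits)
next
  case (Mini f)
  have "step_eval f t (m # xs) = step_eval f s (m # xs)" if "step_eval f s (m # xs) \<noteq> 0" for m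
    using Mini.IH[of "m # xs" "step_eval f s (m # xs) - 1"] that \<open>s \<le> t\<close> by simp
  then show ?case using Mini.prems unfolding step_eval_Mini_iff by force
qed (auto split: if_splits)

lemma step_eval_sound: "step_eval f s xs = Suc y \<Longrightarrow> eval f xs y"
proof (induction f arbitrary: xs y)
  case Zero then show ?case by (auto intro: eval_Zero)
next
  case Succ then show ?case by (cases xs) (auto intro: eval_Succ)
next
  case (Proj i) then show ?case by (auto intro: eval_Proj split: if_splits)
next
  case (Comp f gs)
  have "list_all2 (\<lambda>g y. eval g xs y) gs (map (\<lambda>g. step_eval g s xs - 1) gs)"
    using Comp.prems Comp.IH(2) by (auto simp: list_all2_conv_all_nth split: if_splits)
  then show ?case using Comp.prems Comp.IH(1) by (auto intro: eval_Comp split: if_splits)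
next
  case (Prim f g)
  then obtain n zs where xs: "xs = n # zs" by (cases xs) auto
  let ?R = "rec_nat (step_eval f s zs)
       (\<lambda>n r. if r = 0 then 0 else step_eval g s (n # (r - 1) # zs))"
  have "?R n = Suc z \<Longrightarrow> eval (Prim f g) (n # zs) z" for n z
  proof (induction n arbitrary: z)
    case 0 then show ?case using Prim.IH by (auto intro: eval_Prim0)
  next
    case (Suc n)
    then obtain r where r: "?R n = Suc r" by (cases "?R n") auto
    then show ?case using Suc Prim.IH(2) by (auto intro: eval_PrimS)
  qed
  then show ?case using Prim.prems unfolding xs step_eval_Prim_Cons by blast
next
  case (Mini f)
  note P = Mini.prems[unfolded step_eval_Mini_iff]
  show ?case
  proof (rule eval_Mini)
    show "eval f (y # xs) 0" using P Mini.IH by simp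
    show "\<forall>m<y. \<exists>z. eval f (m # xs) z \<and> z \<noteq> 0"
    proof (intro allI impI)
      fix m assume "m < y"
      with P have m: "1 < step_eval f s (m # xs)" by blast
      then have "eval f (m # xs) (step_eval f s (m # xs) - 1)" by (intro Mini.IH) simp
      then show "\<exists>z. eval f (m # xs) z \<and> z \<noteq> 0" using m by (intro exI conjI) auto
    qed
  qed
qed

text \<open>Each rule depends on finitely many subcomputations, and finitely many eventual
  properties eventually hold together, so no explicit stage has to be computed.\<close>

lemma step_eval_complete: "eval f xs y \<Longrightarrow> \<forall>\<^sub>F s in sequentially. step_eval f s xs = Suc y"
proof (induction rule: eval.induct)
  case (eval_Comp xs gs ys f y)
  have len: "length gs = length ys" using eval_Comp by (auto dest: list_all2_lengthD)
  have "\<forall>\<^sub>F s in sequentially. \<forall>i\<in>{..<length gs}. step_eval (gs ! i) s xs = Suc (ys ! i)"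
    using eval_Comp.IH(1) by (intro eventually_ball_finite) (auto simp: list_all2_conv_all_nth)
  with eval_Comp.IH(2) show ?case
  proof eventually_elim
    case (elim s)
    then have "map (\<lambda>g. step_eval g s xs - 1) gs = ys" using len by (auto intro!: nth_equalityI)
    moreover have "\<not> (\<exists>g\<in>set gs. step_eval g s xs = 0)" using elim by (auto simp: in_set_conv_nth)
    ultimately show ?case using elim by simp
  qed
next
  case (eval_PrimS f g n xs r y)
  from eval_PrimS.IH show ?case
    by eventually_elim (simp add: step_eval_Prim_Cons del: step_eval.simps)
next
  case (eval_Mini f n xs)
  have "\<forall>\<^sub>F s in sequentially. \<forall>m\<in>{..<n}. 1 < step_eval f s (m # xs)"
  proof (intro eventually_ball_finite ballI)
    fix m assume "m \<in> {..<n}"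
    then obtain y where "\<forall>\<^sub>F s in sequentially. step_eval f s (m # xs) = Suc y" "y \<noteq> 0"
      using eval_Mini by auto
    from this(1) show "\<forall>\<^sub>F s in sequentially. 1 < step_eval f s (m # xs)"
      by eventually_elim (use \<open>y \<noteq> 0\<close> in auto)
  qed auto
  with eval_Mini.IH(1) eventually_gt_at_top[of n] show ?case
    by eventually_elim (auto simp: step_eval_Mini_iff simp del: step_eval.simps)
qed auto

lemma eval_iff_step_eval: "eval f xs y \<longleftrightarrow> (\<exists>s. step_eval f s xs = Suc y)"
  using step_eval_sound step_eval_complete
  by (metis (mono_tags, lifting) eventually_sequentially order_refl)

text \<open>By monotonicity, two values can be compared at the larger of their stages.\<close>

lemma eval_deterministic: "eval f xs y \<Longrightarrow> eval f xs z \<Longrightarrow> y = z"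
  unfolding eval_iff_step_eval by (metis nat_le_linear nat.inject step_eval_mono)

lemma dec_pred_ball_list:
  "(\<And>x. x \<in> set xs \<Longrightarrow> dec_pred k (P x)) \<Longrightarrow> dec_pred k (\<lambda>e. \<forall>x\<in>set xs. P x e)"
proof (induction xs)
  case Nil then show ?case by (simp add: dec_pred_def rec_fn_const)
next
  case (Cons x xs)
  then have "dec_pred k (\<lambda>e. P x e \<and> (\<forall>x\<in>set xs. P x e))" by (intro dec_pred_conj) auto
  then show ?case by simp
qed

lemma rec_fn_comp_list:
  assumes "rec_fn (Suc (length Gs)) (\<lambda>e. F (e 0) (map (\<lambda>i. e (Suc i)) [0..<length Gs]))"
    and "rec_fn k S" "\<And>G. G \<in> set Gs \<Longrightarrow> rec_fn k G"
  shows "rec_fn k (\<lambda>e. F (S e) (map (\<lambda>G. G e) Gs))"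
proof -
  have "rec_fn k (\<lambda>e. (\<lambda>e. F (e 0) (map (\<lambda>i. e (Suc i)) [0..<length Gs]))
      ((!) (map (\<lambda>G. G e) (S # Gs))))"
    using assms by (intro rec_fn_comp) auto
  moreover have "map (\<lambda>i. map (\<lambda>G. G e) (S # Gs) ! Suc i) [0..<length Gs] = map (\<lambda>G. G e) Gs" for e
    by (auto intro: nth_equalityI)
  ultimately show ?thesis by simp
qed

text \<open>The program \<open>f\<close> is fixed rather than an argument, so induction on it
  suffices and neither a coding of programs nor a universal function arises.\<close>

lemma rec_fn_step_eval:
  "rec_fn (Suc k) (\<lambda>e. step_eval f (e 0) (map (\<lambda>i. e (Suc i)) [0..<k]))"
proof (induction f arbitrary: k)
  case Zero show ?case by (simp add: rec_fn_const)
next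
  case Succ show ?case
    by (cases k) (auto simp: rec_fn_const simp del: upt_Suc intro!: rec_intros)
next
  case (Proj i) show ?case by (cases "i < k") (auto intro!: rec_intros)
next
  case (Comp f gs)
  have 1: "dec_pred (Suc k) (\<lambda>e. \<forall>g\<in>set gs. \<not> step_eval g (e 0) (map (\<lambda>i. e (Suc i)) [0..<k]) = 0)"
    by (intro dec_pred_ball_list rec_intros Comp.IH)
  let ?Gs = "map (\<lambda>g e. step_eval g (e 0) (map (\<lambda>i. e (Suc i)) [0..<k]) - 1) gs"
  have "rec_fn (Suc k) (\<lambda>e. step_eval f (e 0) (map (\<lambda>G. G e) ?Gs))"
    by (rule rec_fn_comp_list) (auto intro!: Comp.IH rec_fn_proj rec_fn_pred[unfolded One_nat_def])
  then have 2: "rec_fn (Suc k) (\<lambda>e. step_eval f (e 0)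
      (map (\<lambda>g. step_eval g (e 0) (map (\<lambda>i. e (Suc i)) [0..<k]) - 1) gs))"
    by (simp add: o_def)
  have "rec_fn (Suc k) (\<lambda>e. if \<not> (\<forall>g\<in>set gs. \<not> step_eval g (e 0) (map (\<lambda>i. e (Suc i)) [0..<k]) = 0)
    then 0 else step_eval f (e 0)
      (map (\<lambda>g. step_eval g (e 0) (map (\<lambda>i. e (Suc i)) [0..<k]) - 1) gs))"
    by (intro rec_intros 1 2)
  then show ?case by simp
next
  case (Prim f g)
  show ?case
  proof (cases k)
    case 0 then show ?thesis by (simp add: rec_fn_const)
  next
    case (Suc l)
    have map_split: "map (\<lambda>i. e (Suc i)) [0..<Suc l] = e 1 # map (\<lambda>i. e (Suc (Suc i))) [0..<l]" for e :: "nat \<Rightarrow> nat"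
      by (rule nth_equalityI) (auto simp: nth_Cons simp del: upt_Suc split: nat.split)
    have "rec_fn (Suc k) (\<lambda>e. step_eval f (e 0)
        (map (\<lambda>G. G e) (map (\<lambda>i e. e (Suc (Suc i))) [0..<l])))"
      by (rule rec_fn_comp_list) (use Prim.IH(1)[of l] Suc in \<open>auto intro: rec_fn_proj\<close>)
    then have 1: "rec_fn (Suc k) (\<lambda>e. step_eval f (e 0) (map (\<lambda>i. e (Suc (Suc i))) [0..<l]))"
      by (simp add: o_def)
    \<comment> \<open>Inside the recursion, entry 0 is the counter, entry 1 the successor of the
      previous value, entry 2 the cutoff and entry 3 the recursion argument, which is skipped; the
      parameters start at entry 4.\<close>
    have "rec_fn (Suc (Suc (Suc k))) (\<lambda>e. step_eval g (e (Suc (Suc 0))) (map (\<lambda>G. G e)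
        ((\<lambda>e. e 0) # (\<lambda>e. e 1 - 1) # map (\<lambda>i e. e (Suc (Suc (Suc (Suc i))))) [0..<l])))"
      by (rule rec_fn_comp_list)
        (use Prim.IH(2)[of "Suc (Suc l)"] Suc in \<open>auto simp del: upt_Suc intro: rec_fn_proj
          rec_fn_pred[unfolded One_nat_def]\<close>)
    then have 2: "rec_fn (Suc (Suc (Suc k))) (\<lambda>e. step_eval g (e (Suc (Suc 0)))
        (e 0 # (e 1 - 1) # map (\<lambda>i. e (Suc (Suc (Suc (Suc i))))) [0..<l]))"
      by (simp add: o_def)
    have "rec_fn (Suc k) (\<lambda>e. rec_nat (step_eval f (e 0) (map (\<lambda>i. e (Suc (Suc i))) [0..<l]))
       (\<lambda>n r. if r = 0 then 0 else
          step_eval g (e 0) (n # (r - 1) # map (\<lambda>i. e (Suc (Suc i))) [0..<l])) (e 1))"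
      by (intro rec_fn_rec_nat 1 2 rec_intros) (auto simp: Suc)
    then show ?thesis unfolding Suc map_split step_eval_Prim_Cons .
  qed
next
  case (Mini f)
  have 1: "rec_fn m (\<lambda>e. step_eval f (S e) (N e # map (\<lambda>i. E i e) [0..<k]))"
    if "rec_fn m S" "rec_fn m N" "\<And>i. i < k \<Longrightarrow> rec_fn m (E i)" for S N E m
  proof -
    have "rec_fn m (\<lambda>e. step_eval f (S e) (map (\<lambda>G. G e) (N # map E [0..<k])))"
      by (rule rec_fn_comp_list) (use Mini.IH[of "Suc k"] that in \<open>auto simp del: upt_Suc\<close>)
    then show ?thesis by (simp add: o_def)
  qed
  show ?case unfolding step_eval.simps
    by (intro rec_intros 1) auto
qed

section \<open>Total and partial computability in terms of environments and stages\<close>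

lemma total_computable_iff: "total_computable h \<longleftrightarrow> rec_fn 1 (\<lambda>e. h (e 0))"
proof
  assume "total_computable h"
  then obtain f where f: "eval f [n] y \<longleftrightarrow> h n = y" for n y
    unfolding total_computable_def partial_computable_def by auto
  then show "rec_fn 1 (\<lambda>e. h (e 0))"
    unfolding rec_fn_def by (intro exI[of _ f]) (auto simp: length_Suc_conv)
next
  assume "rec_fn 1 (\<lambda>e. h (e 0))"
  then obtain f where "length xs = 1 \<Longrightarrow> eval f xs (h (xs ! 0))" for xs
    unfolding rec_fn_def by blast
  from this[of "[_]"] have "eval f [n] (h n)" for n by simp
  then show "total_computable h"
    unfolding total_computable_def partial_computable_def
    by (intro exI[of _ f]) (auto dest: eval_deterministic)
qed

text \<open>\<open>Mini d\<close> searches for a zero of a function that ignores the search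
  variable, so it returns 0 at once on \<open>D\<close> and diverges elsewhere. \<open>Comp\<close>
  needs the values of all its arguments, so projecting to the second one returns \<open>G\<close>
  and keeps the divergence.\<close>

lemma partial_computable_restrict:
  assumes "dec_pred 1 (\<lambda>e. D (e 0))" "rec_fn 1 (\<lambda>e. G (e 0))"
  shows "partial_computable (\<lambda>n. if D n then Some (G n) else None)"
proof -
  have "rec_fn 2 (\<lambda>e. if D (e 1) then 0 else 1)"
    by (intro dec_pred_comp1[OF assms(1)] rec_intros) simp
  then obtain d where "length xs = 2 \<Longrightarrow> eval d xs (if D (xs ! 1) then 0 else 1)" for xs
    unfolding rec_fn_def by blast
  from this[of "[_, _]"] have d: "eval d [m, n] (if D n then 0 else 1)" for m n by simp
  obtain g where "length xs = 1 \<Longrightarrow> eval g xs (G (xs ! 0))" for xs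
    using assms(2) unfolding rec_fn_def by blast
  from this[of "[_]"] have g: "eval g [n] (G n)" for n by simp
  let ?f = "Comp (Proj 1) [Mini d, g]"
  have "eval ?f [n] (G n)" if "D n" for n
    using d[of 0 n] that g[of n] eval_Proj[of 1 "[0, G n]"]
    by (intro eval_Comp[where ys = "[0, G n]"]) (auto intro: eval_Mini)
  moreover have "D n" if "eval ?f [n] y" for n y
    using that
  proof (cases rule: eval.cases)
    case (eval_Comp ys)
    then obtain z where "eval (Mini d) [n] z" by (auto simp: list_all2_Cons1)
    then have "eval d [z, n] 0" by (cases rule: eval.cases) auto
    with d[of z n] show ?thesis by (metis eval_deterministic zero_neq_one)
  qed
  ultimately show ?thesis
    unfolding partial_computable_def by (intro exI[of _ ?f]) (auto dest: eval_deterministic)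
qed

lemma partial_computable_stages:
  assumes "partial_computable g"
  obtains T where "rec_fn 2 (\<lambda>e. T (e 0) (e 1))"
    "\<And>s t n y. T s n = Suc y \<Longrightarrow> s \<le> t \<Longrightarrow> T t n = Suc y"
    "\<And>n y. g n = Some y \<longleftrightarrow> (\<exists>s. T s n = Suc y)"
proof -
  obtain f where f: "eval f [n] y \<longleftrightarrow> g n = Some y" for n y
    using assms unfolding partial_computable_def by blast
  show thesis
  proof
    show "rec_fn 2 (\<lambda>e. step_eval f (e 0) [e 1])"
      using rec_fn_step_eval[of 1 f] by (simp add: numeral_2_eq_2)
  qed (auto intro: step_eval_mono simp: f[symmetric] eval_iff_step_eval)
qed

section \<open>Computable reals from dyadic approximations\<close>

lemma computable_real_nonneg:
  assumes "0 \<le> x" "computable_real x"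
  obtains a where "rec_fn 1 (\<lambda>e. a (e 0))" "\<And>n. \<bar>x - real (a n) / 2 ^ n\<bar> \<le> 1 / 2 ^ n"
proof -
  obtain a b where ab: "total_computable a" "total_computable b"
    "\<And>n. \<bar>x - (real (a n) - real (b n)) / 2 ^ n\<bar> \<le> 1 / 2 ^ n"
    using assms unfolding computable_real_def by blast
  show thesis
  proof
    show "rec_fn 1 (\<lambda>e. a (e 0) - b (e 0))"
      using ab by (intro rec_intros) (auto simp: total_computable_iff)
    \<comment> \<open>Truncated subtraction is harmless: replacing a negative numerator by 0 moves
      the approximation closer to \<open>x \<ge> 0\<close>.\<close>
    show "\<bar>x - real (a n - b n) / 2 ^ n\<bar> \<le> 1 / 2 ^ n" for n
    proof (cases "b n \<le> a n")
      case False
      then have "(real (a n) - real (b n)) / 2 ^ n \<le> 0" by (intro divide_nonpos_pos) auto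
      with ab(3)[of n] assms(1) False show ?thesis by auto
    qed (use ab(3)[of n] in \<open>simp add: of_nat_diff\<close>)
  qed
qed

lemma computable_realI:
  assumes A: "rec_fn 1 (\<lambda>e. A (e 0))" and E: "rec_fn 1 (\<lambda>e. E (e 0))"
    and approx: "\<And>k. \<bar>x - real (A k) / 2 ^ E k\<bar> \<le> 1 / 2 ^ k"
  shows "computable_real x"
proof -
  \<comment> \<open>the numerator at precision \<open>n\<close> is the rounding of \<open>2 ^ n * A (n + 1) / 2 ^ E (n + 1)\<close> to the nearest integer\<close>
  let ?a = "\<lambda>n. (2 * A (Suc n) * 2 ^ n + 2 ^ E (Suc n)) div (2 * 2 ^ E (Suc n))"
  have "rec_fn 1 (\<lambda>e. ?a (e 0))"
    by (intro rec_intros rec_fn_comp1[OF A] rec_fn_comp1[OF E]) auto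
  moreover have "rec_fn 1 (\<lambda>e. 0)" by (rule rec_fn_const)
  moreover have "\<bar>x - (real (?a n) - real 0) / 2 ^ n\<bar> \<le> 1 / 2 ^ n" for n
  proof -
    let ?u = "2 * A (Suc n) * 2 ^ n + 2 ^ E (Suc n)" and ?v = "2 * 2 ^ E (Suc n) :: nat"
    have r: "real ?u / real ?v = real (?u div ?v) + real (?u mod ?v) / real ?v"
    proof -
      have "real ?u = real (?u div ?v) * real ?v + real (?u mod ?v)"
        by (metis div_mult_mod_eq of_nat_add of_nat_mult)
      then show ?thesis by (simp add: add_divide_distrib del: of_nat_add of_nat_mult of_nat_power)
    qed
    have u: "real ?u / real ?v = 2 ^ n * (real (A (Suc n)) / 2 ^ E (Suc n)) + 1 / 2"
      by (simp add: field_simps)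
    have "0 \<le> real (?u mod ?v) / real ?v" "real (?u mod ?v) / real ?v \<le> 1"
      using mod_less_divisor[of ?v ?u] by (auto simp del: of_nat_mult of_nat_power simp: divide_le_eq)
    then have 1: "\<bar>2 ^ n * (real (A (Suc n)) / 2 ^ E (Suc n)) - real (?u div ?v)\<bar> \<le> 1 / 2"
      using r u by linarith
    \<comment> \<open>After scaling by \<open>2 ^ n\<close>, rounding costs at most 1/2, and so does
      the approximation because it is taken at precision \<open>Suc n\<close>.\<close>
    have "\<bar>2 ^ n * (x - real (A (Suc n)) / 2 ^ E (Suc n))\<bar> \<le> 2 ^ n * (1 / 2 ^ Suc n)"
      unfolding abs_mult using approx[of "Suc n"] by (intro mult_mono) auto
    also have "\<dots> = 1 / 2" by simp
    finally have "\<bar>2 ^ n * x - real (?u div ?v)\<bar> \<le> 1"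
      using 1 unfolding right_diff_distrib by linarith
    moreover have "2 ^ n * x - real (?u div ?v) = 2 ^ n * (x - real (?u div ?v) / 2 ^ n)"
      by (simp add: field_simps)
    ultimately have "2 ^ n * \<bar>x - real (?u div ?v) / 2 ^ n\<bar> \<le> 1" by (simp add: abs_mult)
    then show ?thesis by (simp add: field_simps)
  qed
  ultimately show ?thesis
    unfolding computable_real_def total_computable_iff
    by (intro exI[of _ ?a] exI[of _ "\<lambda>_. 0"]) auto
qed

section \<open>Bit strings, their codes, and cylinders\<close>

text \<open>The code of a string plus one has as binary digits, least significant first, the string
  followed by a leading 1.\<close>

abbreviation bits_val :: "bool list \<Rightarrow> nat" where
  "bits_val \<equiv> horner_sum of_bool 2"

definition string_of :: "nat \<Rightarrow> nat \<Rightarrow> bool list" where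
  "string_of l v = map (bit v) [0..<l]"

lemma Suc_enc: "Suc (enc p) = bits_val (p @ [True])"
  by (induction p) auto

lemma Suc_enc_eq: "Suc (enc p) = 2 ^ length p + bits_val p"
  by (simp add: Suc_enc horner_sum_append)

lemma bits_val_less: "bits_val p < 2 ^ length p"
  by (induction p) auto

lemma length_string_of [simp]: "length (string_of l v) = l"
  by (simp add: string_of_def)

lemma bits_val_string_of: "v < 2 ^ l \<Longrightarrow> bits_val (string_of l v) = v"
  unfolding string_of_def horner_sum_bit_eq_take_bit by (simp add: take_bit_eq_mod)

lemma string_of_bits_val: "string_of (length p) (bits_val p) = p"
  unfolding string_of_def by (rule nth_equalityI) (auto simp: bit_horner_sum_bit_iff)

lemma bits_val_inj: "length p = length q \<Longrightarrow> bits_val p = bits_val q \<Longrightarrow> p = q"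
  by (metis string_of_bits_val)

lemma bits_val_take: "bits_val (take n p) = bits_val p mod 2 ^ n"
  by (simp add: take_bit_horner_sum_bit_eq[symmetric] take_bit_eq_mod)

lemma length_le_enc: "length p \<le> enc p"
  by (induction p) auto

lemma surj_enc: "\<exists>p. enc p = n"
proof (induction n rule: less_induct)
  case (less n)
  show ?case
  proof (cases "n = 0")
    case True then show ?thesis by (intro exI[of _ "[]"]) simp
  next
    case False
    then have "(n - 1) div 2 < n" by simp
    then obtain p where p: "enc p = (n - 1) div 2" using less by blast
    \<comment> \<open>\<open>enc\<close> adds 2 for \<open>True\<close> and 1 for
      \<open>False\<close>, so a positive code is even exactly when the first bit is
      \<open>True\<close>.\<close>
    have "enc (even n # p) = n"
    proof (cases "even n")
      case True
      with False obtain j where "n = 2 * Suc j" by (metis dvdE mult_0_right not0_implies_Suc)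
      with p show ?thesis by simp
    qed (use p in \<open>auto elim!: oddE\<close>)
    then show ?thesis by blast
  qed
qed

text \<open>The floor of the binary logarithm of \<open>n + 1\<close>, as a bounded count so that
  the closure rules apply; \<open>i < n\<close> suffices because no string is longer than its
  code.\<close>

definition code_length :: "nat \<Rightarrow> nat" where
  "code_length n = (\<Sum>i<n. if 2 ^ Suc i \<le> Suc n then 1 else 0)"

lemma code_length_enc [simp]: "code_length (enc p) = length p"
proof -
  have lt: "Suc (enc p) < 2 ^ Suc (length p)" "2 ^ length p \<le> Suc (enc p)"
    using bits_val_less[of p] by (simp_all add: Suc_enc_eq)
  have "2 ^ Suc i \<le> Suc (enc p) \<longleftrightarrow> i < length p" for i
  proof
    assume "2 ^ Suc i \<le> Suc (enc p)"
    with lt(1) have "(2::nat) ^ Suc i < 2 ^ Suc (length p)" by linarith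
    then show "i < length p" by (subst (asm) power_strict_increasing_iff) auto
  next
    assume "i < length p"
    then have "(2::nat) ^ Suc i \<le> 2 ^ length p" by (intro power_increasing) auto
    with lt(2) show "2 ^ Suc i \<le> Suc (enc p)" by linarith
  qed
  then have "code_length (enc p) = card ({..<enc p} \<inter> {..<length p})"
    unfolding code_length_def by (simp add: sum.If_cases lessThan_def del: power_Suc)
  also have "{..<enc p} \<inter> {..<length p} = {..<length p}"
    using length_le_enc[of p] by (intro Int_absorb1) (simp add: lessThan_subset_iff)
  finally show ?thesis by simp
qed

lemma inj_enc: "inj enc"
proof (rule injI)
  fix p q assume eq: "enc p = enc q"
  then have "length p = length q" by (metis code_length_enc)
  moreover from this have "bits_val p = bits_val q" using eq Suc_enc_eq[of p] Suc_enc_eq[of q] by simp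
  ultimately show "p = q" by (rule bits_val_inj)
qed

lemma code_length_le: "code_length n \<le> n"
  using surj_enc[of n] length_le_enc by (metis code_length_enc)

lemma rec_fn_code_length: "rec_fn k F \<Longrightarrow> rec_fn k (\<lambda>e. code_length (F e))"
  by (rule rec_fn_comp1[where f = code_length])
    (unfold code_length_def, (intro rec_intros; simp))

text \<open>The string read most significant bit first, so that extensions of a string correspond to
  a dyadic subinterval.\<close>

definition code_rev_val :: "nat \<Rightarrow> nat" where
  "code_rev_val n = (\<Sum>i<code_length n. if odd (Suc n div 2 ^ i) then 2 ^ (code_length n - Suc i) else 0)"

lemma code_rev_val_enc: "code_rev_val (enc p) = bits_val (rev p)"
proof -
  have o: "odd (Suc (enc p) div 2 ^ i) \<longleftrightarrow> p ! i" if "i < length p" for i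
    using that unfolding Suc_enc bit_iff_odd[symmetric] bit_horner_sum_bit_iff by (auto simp: nth_append)
  have "bits_val (rev p) = (\<Sum>i<length p. of_bool (rev p ! i) * 2 ^ i)"
    by (simp add: horner_sum_eq_sum atLeast0LessThan)
  also have "\<dots> = (\<Sum>i<length p. of_bool (rev p ! (length p - Suc i)) * 2 ^ (length p - Suc i))"
    by (rule sum.nat_diff_reindex[symmetric])
  also have "\<dots> = code_rev_val (enc p)"
    unfolding code_rev_val_def code_length_enc
    by (intro sum.cong) (auto simp: o rev_nth)
  finally show ?thesis by simp
qed

lemma rec_fn_code_rev_val: "rec_fn k F \<Longrightarrow> rec_fn k (\<lambda>e. code_rev_val (F e))"
  by (rule rec_fn_comp1[where f = code_rev_val])
    (unfold code_rev_val_def, (intro rec_intros rec_fn_code_length; simp))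

lemma rev_val_prefix:
  assumes "prefix p q"
  shows "bits_val (rev q) div 2 ^ (length q - length p) = bits_val (rev p)"
proof -
  obtain r where q: "q = p @ r" using assms by (auto simp: prefix_def)
  show ?thesis using bits_val_less[of "rev r"] by (simp add: q horner_sum_append)
qed

lemma length_init_seg [simp]: "length (init_seg X n) = n"
  by (simp add: init_seg_def)

lemma take_init_seg: "l \<le> n \<Longrightarrow> take l (init_seg X n) = init_seg X l"
  by (simp add: init_seg_def take_map)

text \<open>Every sufficiently long string with value \<open>v\<close> has a prefix in \<open>canon k\<close>; the displayed
  equation says that the string with code \<open>i\<close> is such a prefix.\<close>

definition extends_canon :: "nat \<Rightarrow> nat \<Rightarrow> bool" where
  "extends_canon k v \<longleftrightarrow>
    (\<exists>i<k. odd (k div 2 ^ i) \<and> Suc i = 2 ^ code_length i + v mod 2 ^ code_length i)"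

lemma dec_pred_extends_canon:
  assumes "rec_fn k F" "rec_fn k G"
  shows "dec_pred k (\<lambda>e. extends_canon (F e) (G e))"
proof -
  have "dec_pred 2 (\<lambda>e. extends_canon (e 0) (e 1))"
    unfolding extends_canon_def by (intro rec_intros rec_fn_code_length) auto
  from dec_pred_comp2[OF this assms] show ?thesis .
qed

lemma canon_enc_less: "\<sigma> \<in> canon k \<Longrightarrow> enc \<sigma> < k"
proof (rule ccontr)
  assume "\<sigma> \<in> canon k" "\<not> enc \<sigma> < k"
  then have "k < 2 ^ enc \<sigma>" by (metis less_exp not_less order_le_less_trans)
  then show False using \<open>\<sigma> \<in> canon k\<close> by (simp add: canon_def)
qed

text \<open>A string in \<open>canon k\<close> is no longer than its code, which is below
  \<open>k\<close>, so \<open>L \<ge> k\<close> bits decide membership. The bound is crude but read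
  off directly from \<open>k\<close>.\<close>

lemma cyl_canon_iff:
  assumes "k \<le> L"
  shows "X \<in> cyl (canon k) \<longleftrightarrow> extends_canon k (bits_val (init_seg X L))"
proof -
  have eq: "init_seg X (length \<sigma>) = \<sigma> \<longleftrightarrow>
      Suc (enc \<sigma>) = 2 ^ length \<sigma> + bits_val (init_seg X L) mod 2 ^ length \<sigma>" if "enc \<sigma> < k" for \<sigma>
  proof -
    have "length \<sigma> \<le> L" using that assms length_le_enc[of \<sigma>] by linarith
    then have "bits_val (init_seg X L) mod 2 ^ length \<sigma> = bits_val (init_seg X (length \<sigma>))"
      by (simp add: bits_val_take[symmetric] take_init_seg)
    then show ?thesis
      unfolding Suc_enc_eq by (metis add_left_cancel bits_val_inj length_init_seg)
  qed
  show ?thesis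
  proof
    assume "X \<in> cyl (canon k)"
    then obtain \<sigma> where "\<sigma> \<in> canon k" "init_seg X (length \<sigma>) = \<sigma>" by (auto simp: cyl_def)
    then show "extends_canon k (bits_val (init_seg X L))"
      unfolding extends_canon_def using eq canon_enc_less[of \<sigma> k]
      by (intro exI[of _ "enc \<sigma>"]) (auto simp: canon_def)
  next
    assume "extends_canon k (bits_val (init_seg X L))"
    then obtain i where i: "i < k" "odd (k div 2 ^ i)"
      "Suc i = 2 ^ code_length i + bits_val (init_seg X L) mod 2 ^ code_length i"
      unfolding extends_canon_def by blast
    obtain \<sigma> where "enc \<sigma> = i" using surj_enc by blast
    with i eq[of \<sigma>] show "X \<in> cyl (canon k)" by (auto simp: cyl_def canon_def)
  qed
qed

lemma canon_0: "canon 0 = {}"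
  by (simp add: canon_def)

lemma canon_power_enc: "canon (2 ^ enc \<sigma>) = {\<sigma>}"
proof -
  have "odd ((2::nat) ^ a div 2 ^ b) \<longleftrightarrow> a = b" for a b
    using bit_exp_iff[of a b, where 'a = nat] by (auto simp: bit_iff_odd possible_bit_def)
  then show ?thesis by (auto simp: canon_def inj_enc inj_eq)
qed

section \<open>Measure of cylinders and Kraft's inequality\<close>

interpretation cantor: prob_space cantor_measure
  unfolding cantor_measure_def by (rule prob_space_PiM) (rule measure_pmf.prob_space_axioms)

lemma cyl_singleton: "cyl {\<sigma>} = {X. \<forall>i<length \<sigma>. X i = \<sigma> ! i}"
proof -
  have "init_seg X (length \<sigma>) = \<sigma> \<longleftrightarrow> (\<forall>i<length \<sigma>. X i = \<sigma> ! i)" for X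
    unfolding list_eq_iff_nth_eq by (simp add: init_seg_def)
  then show ?thesis by (simp add: cyl_def)
qed

lemma cyl_singleton_emb:
  "cyl {\<sigma>} = prod_emb UNIV (\<lambda>_. measure_pmf (bernoulli_pmf (1/2))) {..<length \<sigma>}
     (\<Pi>\<^sub>E i\<in>{..<length \<sigma>}. {\<sigma> ! i})"
  by (rule set_eqI) (simp add: cyl_singleton prod_emb_iff Pi_iff Ball_def)

lemma sets_cyl_singleton: "cyl {\<sigma>} \<in> sets cantor_measure"
  unfolding cyl_singleton_emb cantor_measure_def by (intro sets_PiM_I) auto

lemma measure_cyl_singleton: "measure cantor_measure (cyl {\<sigma>}) = (1/2) ^ length \<sigma>"
proof -
  interpret product_prob_space "\<lambda>_. measure_pmf (bernoulli_pmf (1/2))" "UNIV :: nat set" ..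
  have "pmf (bernoulli_pmf (1/2)) b = 1/2" for b by (cases b) auto
  then show ?thesis
    unfolding cyl_singleton_emb cantor_measure_def
    by (subst measure_PiM_emb) (auto simp: measure_pmf_single)
qed

lemma measure_cyl_prefix_free:
  assumes "finite A" "prefix_free A"
  shows "measure cantor_measure (cyl A) = (\<Sum>\<sigma>\<in>A. (1/2) ^ length \<sigma>)"
proof -
  have "disjoint_family_on (\<lambda>\<sigma>. cyl {\<sigma>}) A"
    unfolding disjoint_family_on_def
  proof (intro ballI impI)
    fix p q assume pq: "p \<in> A" "q \<in> A" "p \<noteq> q"
    have False if "X \<in> cyl {p}" "X \<in> cyl {q}" for X
    proof -
      have "init_seg X (length p) = p" "init_seg X (length q) = q" using that by (auto simp: cyl_def)
      then have "prefix p q \<or> prefix q p"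
        by (metis linear take_init_seg take_is_prefix)
      then show False using pq assms(2) by (auto simp: prefix_free_def)
    qed
    then show "cyl {p} \<inter> cyl {q} = {}" by blast
  qed
  then have "measure cantor_measure (\<Union>\<sigma>\<in>A. cyl {\<sigma>}) = (\<Sum>\<sigma>\<in>A. measure cantor_measure (cyl {\<sigma>}))"
    using assms(1) sets_cyl_singleton by (intro cantor.finite_measure_finite_Union) auto
  moreover have "cyl A = (\<Union>\<sigma>\<in>A. cyl {\<sigma>})" by (auto simp: cyl_def)
  ultimately show ?thesis by (simp add: measure_cyl_singleton)
qed

text \<open>Kraft's inequality: the cylinders of a finite prefix-free set are disjoint, so their
  measures add up to at most 1. Summability matters because a divergent infinite sum is 0 by
  convention, which would empty \<open>domain_measure\<close> of meaning.\<close>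

lemma kraft_summable:
  assumes "prefix_free A"
  shows "(\<lambda>p. (1/2::real) ^ length p) summable_on A"
proof (rule nonneg_bounded_partial_sums_imp_summable_on)
  have "(\<Sum>p\<in>F. (1/2::real) ^ length p) \<le> 1" if "finite F" "F \<subseteq> A" for F
  proof -
    have "prefix_free F" using assms that by (auto simp: prefix_free_def)
    from measure_cyl_prefix_free[OF \<open>finite F\<close> this] show ?thesis using cantor.prob_le_1 by metis
  qed
  then show "\<forall>\<^sub>F F in finite_subsets_at_top A. (\<Sum>p\<in>F. (1/2::real) ^ length p) \<le> 1"
    by (intro eventually_finite_subsets_at_top_weakI) auto
qed auto

text \<open>The strings of length \<open>L\<close> that extend a member of \<open>canon k\<close>
  generate the same set by disjoint cylinders, so overlaps within \<open>canon k\<close> are not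
  counted twice.\<close>

lemma measure_cyl_canon:
  assumes "k \<le> L"
  shows "measure cantor_measure (cyl (canon k)) = real (card {v. v < 2 ^ L \<and> extends_canon k v}) / 2 ^ L"
proof -
  let ?V = "{v. v < 2 ^ L \<and> extends_canon k v}"
  let ?A = "string_of L ` ?V"
  have inj: "inj_on (string_of L) ?V"
    by (rule inj_onI) (metis (mono_tags, lifting) bits_val_string_of mem_Collect_eq)
  have "X \<in> cyl (canon k) \<longleftrightarrow> X \<in> cyl ?A" for X
  proof -
    have "X \<in> cyl ?A \<longleftrightarrow> (\<exists>v\<in>?V. init_seg X L = string_of L v)" by (auto simp: cyl_def)
    also have "\<dots> \<longleftrightarrow> extends_canon k (bits_val (init_seg X L))"
      using bits_val_less[of "init_seg X L"] string_of_bits_val[of "init_seg X L"] bits_val_string_of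
      by auto
    finally show ?thesis using cyl_canon_iff[OF assms] by blast
  qed
  then have "cyl (canon k) = cyl ?A" by blast
  moreover have "prefix_free ?A"
    unfolding prefix_free_def
  proof (intro ballI impI)
    fix p q assume "p \<in> ?A" "q \<in> ?A" "prefix p q"
    moreover from this have "length p = L" "length q = L" by auto
    ultimately show "p = q" by (auto simp: prefix_def)
  qed
  ultimately have "measure cantor_measure (cyl (canon k)) = (\<Sum>\<sigma>\<in>?A. (1/2) ^ length \<sigma>)"
    by (simp add: measure_cyl_prefix_free)
  also have "\<dots> = (\<Sum>\<sigma>\<in>?A. (1/2) ^ L)" by (intro sum.cong) auto
  also have "\<dots> = real (card ?V) / 2 ^ L" by (simp add: card_image[OF inj] power_one_over)
  finally show ?thesis .
qed

section \<open>From machines to Schnorr tests\<close>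

lemma sum_eq_single:
  assumes "finite A" "a \<in> A" "\<And>x. x \<in> A \<Longrightarrow> x \<noteq> a \<Longrightarrow> f x = 0"
  shows "sum f A = f a"
  using sum.remove[OF assms(1,2), of f] assms(3) by (simp add: sum.neutral)

text \<open>Expresses pairing by operations covered by the closure rules.\<close>

lemma prod_encode_eq: "prod_encode (a, b) = (a + b) * Suc (a + b) div 2 + a"
  by (simp add: prod_encode_def triangle_def)

lemma K_leE:
  assumes "K C \<sigma> \<le> enat k"
  obtains p where "C p = Some \<sigma>" "length p \<le> k"
proof -
  let ?S = "(\<lambda>p. enat (length p)) ` {p. C p = Some \<sigma>}"
  have "?S \<noteq> {}" using assms by (auto simp: K_def Inf_enat_def split: if_splits)
  then have "Inf ?S \<in> ?S" by (metis Inf_enat_def LeastI_ex ex_in_conv)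
  then show thesis using assms that unfolding K_def by auto
qed

lemma machine_imp_schnorr_test:
  assumes C: "computable_measure_machine C"
    and inf: "infinite {n. K C (init_seg X n) \<le> enat (n + d)}"
  shows "\<exists>h. schnorr_test h \<and> \<not> passes X h"
proof -
  obtain g where g: "partial_computable g" "\<And>p. g (enc p) = map_option enc (C p)"
    and pf: "prefix_free (dom C)" and M: "computable_real (domain_measure C)"
    using C unfolding computable_measure_machine_def partial_computable_string_fun_def by blast
  obtain T where T: "rec_fn 2 (\<lambda>e. T (e 0) (e 1))"
    and mono: "\<And>s t n y. T s n = Suc y \<Longrightarrow> s \<le> t \<Longrightarrow> T t n = Suc y"
    and gT: "\<And>n y. g n = Some y \<longleftrightarrow> (\<exists>s. T s n = Suc y)"
    using partial_computable_stages[OF g(1)] by blast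
  note rec_T = rec_fn_comp2[OF T]
  have out: "T s n - 1 = the (g n)" "g n \<noteq> None" if "T s n \<noteq> 0" for s n
  proof -
    have "g n = Some (T s n - 1)" using that unfolding gT by (intro exI[of _ s]) simp
    then show "T s n - 1 = the (g n)" "g n \<noteq> None" by auto
  qed

  define D where "D = {n. g n \<noteq> None}"
  define w :: "nat \<Rightarrow> real" where "w n = (1/2) ^ code_length n" for n
  define val :: "nat \<Rightarrow> real" where "val n = (1/2) ^ code_length (the (g n))" for n
  define G where "G = {n \<in> D. code_length n \<le> code_length (the (g n)) + d}"
  let ?M = "domain_measure C"
  have D: "D = enc ` dom C"
  proof -
    have "n \<in> D \<longleftrightarrow> n \<in> enc ` dom C" for n
    proof -
      obtain p where p: "n = enc p" using surj_enc by metis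
      show ?thesis
        unfolding p inj_image_mem_iff[OF inj_enc] using g(2)[of p] by (auto simp: D_def)
    qed
    then show ?thesis by blast
  qed
  have wD: "(w has_sum ?M) D"
  proof -
    have "((\<lambda>p. (1/2::real) ^ length p) has_sum ?M) (dom C)"
      unfolding domain_measure_def using kraft_summable[OF pf] by (rule has_sum_infsum)
    then show ?thesis
      unfolding D using inj_enc by (subst has_sum_reindex) (auto simp: o_def w_def inj_on_def inj_def)
  qed
  then have M0: "0 \<le> ?M" by (rule has_sum_nonneg) (simp add: w_def)
  have val_le: "val n \<le> 2 ^ d * w n" if "n \<in> G" for n
  proof -
    have "(1/2::real) ^ (code_length (the (g n)) + d) \<le> (1/2) ^ code_length n"
      using that by (intro power_decreasing) (auto simp: G_def)
    then show ?thesis by (simp add: val_def w_def power_add power_one_over field_simps)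
  qed
  have "val summable_on G"
  proof (rule summable_on_comparison_test)
    show "(\<lambda>n. 2 ^ d * w n) summable_on G"
      by (intro summable_on_cmult_right summable_on_subset_banach[OF has_sum_imp_summable[OF wD]])
        (auto simp: G_def)
  qed (use val_le in \<open>auto simp: val_def\<close>)
  then obtain V where V: "(val has_sum V) G" using has_sum_infsum by blast
  then have VD: "((\<lambda>n. if n \<in> G then val n else 0) has_sum V) D"
    by (rule has_sum_cong_neutral[THEN iffD1, rotated -1]) (auto simp: G_def)

  \<comment> \<open>The error of the stage-\<open>t\<close> approximation to \<open>V\<close> is controlled by that to the measure of
    the domain, which is computable.\<close>
  define D_at where "D_at t = {n. n < t \<and> T t n \<noteq> 0}" for t
  have D_at: "finite (D_at t)" "D_at t \<subseteq> D" for t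
    using out by (auto simp: D_at_def D_def)
  have V_error: "0 \<le> V - sum val (G \<inter> D_at t)"
    "V - sum val (G \<inter> D_at t) \<le> 2 ^ d * (?M - sum w (D_at t))" for t
  proof -
    show "0 \<le> V - sum val (G \<inter> D_at t)"
      using D_at by (simp, intro finite_sum_le_has_sum[OF V]) (auto simp: val_def)
    \<comment> \<open>The excess of the dominating series over that of \<open>V\<close>, extended by
      0 to \<open>D\<close>. Its terms are nonnegative, so partial sums stay below the total;
      rearranged, this compares the tails.\<close>
    let ?u = "\<lambda>n. 2 ^ d * w n - (if n \<in> G then val n else 0)"
    have "(?u has_sum (2 ^ d * ?M - V)) D"
      using has_sum_add[OF has_sum_cmult_right[OF wD, of "2 ^ d"] has_sum_cmult_right[OF VD, of "- 1"]]
      by simp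
    then have "sum ?u (D_at t) \<le> 2 ^ d * ?M - V"
      using D_at val_le by (intro finite_sum_le_has_sum) (auto simp: w_def)
    moreover have "sum ?u (D_at t) = 2 ^ d * sum w (D_at t) - sum val (G \<inter> D_at t)"
      using sum.inter_restrict[OF D_at(1), of val t G]
      by (simp add: sum_subtractf sum_distrib_left Int_commute)
    ultimately show "V - sum val (G \<inter> D_at t) \<le> 2 ^ d * (?M - sum w (D_at t))"
      by (simp add: algebra_simps)
  qed
  have approach: "\<exists>t. ?M - \<epsilon> < sum w (D_at t)" if "\<epsilon> > 0" for \<epsilon>
  proof -
    have "\<forall>\<^sub>F F in finite_subsets_at_top D. ?M - \<epsilon> < sum w F"
      using wD that unfolding has_sum_def by (intro order_tendstoD(1)) auto
    then obtain F where F: "finite F" "F \<subseteq> D" "?M - \<epsilon> < sum w F"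
      unfolding eventually_finite_subsets_at_top by blast
    have "\<forall>\<^sub>F t in sequentially. \<forall>n\<in>F. n \<in> D_at t"
    proof (intro eventually_ball_finite ballI F(1))
      fix n assume "n \<in> F"
      then have "n \<in> D" using F(2) by blast
      then obtain y where "g n = Some y" by (auto simp: D_def)
      then obtain s where s: "T s n = Suc y" using gT by blast
      have "T t n \<noteq> 0" if "s \<le> t" for t using mono[OF s that] by simp
      then show "\<forall>\<^sub>F t in sequentially. n \<in> D_at t"
        unfolding D_at_def eventually_sequentially by (intro exI[of _ "s + Suc n"]) auto
    qed
    then obtain t where "F \<subseteq> D_at t" unfolding eventually_sequentially by blast
    then have "sum w F \<le> sum w (D_at t)" using D_at by (intro sum_mono2) (auto simp: w_def)
    with F show ?thesis by (intro exI[of _ t]) linarith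
  qed

  define num_M :: "nat \<Rightarrow> nat" where "num_M t = (\<Sum>n<t. if T t n \<noteq> 0 then 2 ^ (t - code_length n) else 0)" for t
  \<comment> \<open>Outputs present at stage \<open>t\<close> may be longer than \<open>t\<close>.
    The sum of all values bounds each of them, hence also their lengths, and so serves as a common
    exponent.\<close>
  define den_V where "den_V t = (\<Sum>n<t. T t n)" for t
  define num_V :: "nat \<Rightarrow> nat" where "num_V t = (\<Sum>n<t.
    if T t n \<noteq> 0 \<and> code_length n \<le> code_length (T t n - 1) + d
    then 2 ^ (den_V t - code_length (T t n - 1)) else 0)" for t
  have dyadic: "real (2 ^ (a - b)) / 2 ^ a = (1/2) ^ b" if "b \<le> a" for a b
  proof -
    have "(2::real) ^ a = 2 ^ (a - b) * 2 ^ b" using that by (simp flip: power_add)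
    then show ?thesis by (simp add: power_one_over)
  qed
  have num_M: "real (num_M t) / 2 ^ t = sum w (D_at t)" for t
  proof -
    have "real (num_M t) / 2 ^ t = (\<Sum>n<t. if T t n \<noteq> 0 then w n else 0)"
      unfolding num_M_def of_nat_sum sum_divide_distrib
    proof (rule sum.cong)
      fix n assume "n \<in> {..<t}"
      then have "code_length n \<le> t" using code_length_le[of n] by simp
      from dyadic[OF this] show "real (if T t n \<noteq> 0 then 2 ^ (t - code_length n) else 0) / 2 ^ t =
          (if T t n \<noteq> 0 then w n else 0)" by (simp add: w_def)
    qed simp
    also have "\<dots> = sum w {n \<in> {..<t}. T t n \<noteq> 0}" by (rule sum.inter_filter[symmetric]) simp
    finally show ?thesis by (simp add: D_at_def)
  qed
  have num_V: "real (num_V t) / 2 ^ den_V t = sum val (G \<inter> D_at t)" for t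
  proof -
    let ?P = "\<lambda>n. T t n \<noteq> 0 \<and> code_length n \<le> code_length (T t n - 1) + d"
    have "real (num_V t) / 2 ^ den_V t = (\<Sum>n<t. if ?P n then val n else 0)"
      unfolding num_V_def of_nat_sum sum_divide_distrib
    proof (rule sum.cong)
      fix n assume "n \<in> {..<t}"
      then have "T t n \<le> den_V t" unfolding den_V_def by (intro member_le_sum) auto
      then have le: "code_length (T t n - 1) \<le> den_V t" using code_length_le[of "T t n - 1"] by simp
      show "real (if ?P n then 2 ^ (den_V t - code_length (T t n - 1)) else 0) / 2 ^ den_V t =
          (if ?P n then val n else 0)"
      proof (cases "?P n")
        case True
        then have "T t n - 1 = the (g n)" using out(1) by blast
        with True dyadic[OF le] show ?thesis
          by (simp add: val_def)
      qed (auto simp: val_def)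
    qed simp
    also have "\<dots> = sum val {n \<in> {..<t}. ?P n}" by (rule sum.inter_filter[symmetric]) simp
    also have "{n \<in> {..<t}. ?P n} = G \<inter> D_at t"
      using out[of t] by (auto simp: D_at_def G_def D_def)
    finally show ?thesis .
  qed

  obtain a where a: "rec_fn 1 (\<lambda>e. a (e 0))" "\<And>n. \<bar>?M - real (a n) / 2 ^ n\<bar> \<le> 1 / 2 ^ n"
    using computable_real_nonneg[OF M0 M] by blast
  \<comment> \<open>One unit of \<open>1 / 2 ^ k\<close> absorbs the error of \<open>a k\<close>;
    the other makes the search end, since the stage sums need only come arbitrarily close to
    \<open>?M\<close>. Denominators are cleared to stay within the natural numbers.\<close>
  define stage where "stage k = (LEAST t. a k * 2 ^ t \<le> num_M t * 2 ^ k + 2 * 2 ^ t)" for k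
  have stage_iff: "a k * 2 ^ t \<le> num_M t * 2 ^ k + 2 * 2 ^ t \<longleftrightarrow>
      real (a k) / 2 ^ k - 2 / 2 ^ k \<le> sum w (D_at t)" for k t
  proof -
    have "a k * 2 ^ t \<le> num_M t * 2 ^ k + 2 * 2 ^ t \<longleftrightarrow>
        real (a k * 2 ^ t) \<le> real (num_M t * 2 ^ k + 2 * 2 ^ t)"
      by (simp only: of_nat_le_iff)
    also have "\<dots> \<longleftrightarrow> real (a k) / 2 ^ k - 2 / 2 ^ k \<le> real (num_M t) / 2 ^ t"
      by (simp add: field_simps)
    finally show ?thesis unfolding num_M .
  qed
  have stage_ex: "\<exists>t. a k * 2 ^ t \<le> num_M t * 2 ^ k + 2 * 2 ^ t" for k
  proof -
    obtain t where "?M - 1 / 2 ^ k < sum w (D_at t)" using approach[of "1 / 2 ^ k"] by auto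
    moreover have "2 / 2 ^ k = 1 / 2 ^ k + (1 / 2 ^ k :: real)" by simp
    ultimately show ?thesis unfolding stage_iff using a(2)[of k] by (intro exI[of _ t]) linarith
  qed
  have stage: "?M - sum w (D_at (stage k)) \<le> 3 / 2 ^ k" for k
  proof -
    have "a k * 2 ^ stage k \<le> num_M (stage k) * 2 ^ k + 2 * 2 ^ stage k"
      unfolding stage_def by (rule LeastI_ex[OF stage_ex])
    then have "real (a k) / 2 ^ k - 2 / 2 ^ k \<le> sum w (D_at (stage k))" unfolding stage_iff .
    moreover have "3 / 2 ^ k = 1 / 2 ^ k + (2 / 2 ^ k :: real)" by (simp add: field_simps)
    ultimately show ?thesis using a(2)[of k] by linarith
  qed
  have rec_num_M: "rec_fn k F \<Longrightarrow> rec_fn k (\<lambda>e. num_M (F e))" for k F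
    by (rule rec_fn_comp1[where f = num_M])
      (unfold num_M_def, (intro rec_intros rec_fn_code_length rec_T; simp))
  have rec_den_V: "rec_fn k F \<Longrightarrow> rec_fn k (\<lambda>e. den_V (F e))" for k F
    by (rule rec_fn_comp1[where f = den_V]) (unfold den_V_def, (intro rec_intros rec_T; simp))
  have rec_num_V: "rec_fn k F \<Longrightarrow> rec_fn k (\<lambda>e. num_V (F e))" for k F
    by (rule rec_fn_comp1[where f = num_V])
      (unfold num_V_def, (intro rec_intros rec_fn_code_length rec_T rec_den_V; simp))
  have rec_stage: "rec_fn k F \<Longrightarrow> rec_fn k (\<lambda>e. stage (F e))" for k F
    by (rule rec_fn_comp1[where f = stage])
      (unfold stage_def, (intro rec_fn_Least rec_intros rec_num_M rec_fn_comp1[OF a(1)] stage_ex; simp))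
  have V_comp: "computable_real V"
  proof (rule computable_realI)
    \<comment> \<open>The shift \<open>d + 2\<close> compensates for the factors
      \<open>2 ^ d\<close> and 3: \<open>2 ^ d * 3 / 2 ^ (k + d + 2)\<close> is three quarters of
      \<open>1 / 2 ^ k\<close>.\<close>
    show "rec_fn 1 (\<lambda>e. num_V (stage (e 0 + d + 2)))" "rec_fn 1 (\<lambda>e. den_V (stage (e 0 + d + 2)))"
      by (intro rec_num_V rec_den_V rec_stage rec_intros; simp)+
    fix k
    let ?t = "stage (k + d + 2)"
    have "2 ^ d * (?M - sum w (D_at ?t)) \<le> 2 ^ d * (3 / 2 ^ (k + d + 2))"
      by (intro mult_left_mono stage) simp
    also have "\<dots> \<le> 1 / 2 ^ k" by (simp add: power_add field_simps)
    finally show "\<bar>V - real (num_V ?t) / 2 ^ den_V ?t\<bar> \<le> 1 / 2 ^ k"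
      unfolding num_V using V_error[of ?t] by linarith
  qed

  \<comment> \<open>Each element of the domain gets one test component, indexed by it and its first stage.\<close>
  define first where "first n = (LEAST s. T s n \<noteq> 0)" for n
  have first_ex: "\<exists>s. T s n \<noteq> 0" if n: "n \<in> D" for n
  proof -
    obtain y where "g n = Some y" using n by (auto simp: D_def)
    then obtain s where "T s n = Suc y" using gT by blast
    then show ?thesis by (intro exI[of _ s]) simp
  qed
  have first_iff: "s = first n \<longleftrightarrow> T s n \<noteq> 0 \<and> (\<forall>r<s. T r n = 0)" if "n \<in> D" for s n
  proof
    assume "s = first n"
    then show "T s n \<noteq> 0 \<and> (\<forall>r<s. T r n = 0)"
      unfolding first_def using LeastI_ex[OF first_ex[OF that]] not_less_Least by blast
  next
    assume "T s n \<noteq> 0 \<and> (\<forall>r<s. T r n = 0)"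
    then show "s = first n"
      unfolding first_def by (intro Least_equality[symmetric]) (auto simp: not_less[symmetric])
  qed
  define ix where "ix n = prod_encode (n, first n)" for n
  have inj_ix: "inj_on ix A" for A by (auto simp: inj_on_def ix_def)
  \<comment> \<open>Both coordinates of a pair are at most its code \<open>m\<close>, so the search
    is bounded, and at most one term is nonzero. A power \<open>2 ^ c\<close> is the index of the
    singleton of the string with code \<open>c\<close>; the default 0 is the index of the empty
    set.\<close>
  define h :: "nat \<Rightarrow> nat" where "h m = (\<Sum>n<Suc m. \<Sum>s<Suc m.
    if (n + s) * Suc (n + s) div 2 + n = m \<and> T s n \<noteq> 0 \<and> (\<forall>r<s. T r n = 0) \<and>
      code_length n \<le> code_length (T s n - 1) + d
    then 2 ^ (T s n - 1) else 0)" for m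
  have "rec_fn 1 (\<lambda>e. h (e 0))"
    unfolding h_def by (intro rec_intros rec_fn_code_length rec_T; simp)
  then have h_comp: "total_computable h" by (simp add: total_computable_iff)
  have cond: "(n + s) * Suc (n + s) div 2 + n = m \<and> T s n \<noteq> 0 \<and> (\<forall>r<s. T r n = 0) \<and>
      code_length n \<le> code_length (T s n - 1) + d \<longleftrightarrow> n \<in> G \<and> s = first n \<and> m = ix n" for n s m
  proof (cases "n \<in> D")
    case True
    then show ?thesis
      unfolding prod_encode_eq[symmetric] using first_iff[OF True, of s] out[of s n]
      by (auto simp: G_def ix_def)
  next
    case False
    then show ?thesis using out(2)[of s n] by (auto simp: G_def D_def)
  qed
  have h_ix: "h (ix n) = 2 ^ the (g n)" if "n \<in> G" for n
  proof -
    have le: "n < Suc (ix n)" "first n < Suc (ix n)"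
      unfolding ix_def using le_prod_encode_1 le_prod_encode_2 by (auto simp: less_Suc_eq_le)
    let ?f = "\<lambda>k s. if k \<in> G \<and> s = first k \<and> ix n = ix k then 2 ^ (T s k - 1) else (0::nat)"
    have ix_eq: "ix n = ix k \<longleftrightarrow> k = n" for k by (auto simp: ix_def)
    have "h (ix n) = (\<Sum>k<Suc (ix n). \<Sum>s<Suc (ix n). ?f k s)"
      unfolding h_def cond ..
    also have "\<dots> = (\<Sum>s<Suc (ix n). ?f n s)"
      using le by (intro sum_eq_single) (auto simp: ix_eq)
    also have "\<dots> = ?f n (first n)"
      using le by (intro sum_eq_single) auto
    also have "\<dots> = 2 ^ the (g n)"
      using that out(1)[of "first n" n] first_iff[of n "first n"] by (auto simp: G_def)
    finally show ?thesis .
  qed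
  have h_0: "h m = 0" if "m \<notin> ix ` G" for m
    unfolding h_def cond using that by (intro sum.neutral ballI) auto
  have canon_h: "canon (h (ix n)) = {\<sigma>}" if "n \<in> G" "enc \<sigma> = the (g n)" for n \<sigma>
    unfolding h_ix[OF that(1)] that(2)[symmetric] by (rule canon_power_enc)
  let ?\<mu> = "\<lambda>m. measure cantor_measure (cyl (canon (h m)))"
  have \<mu>_ix: "?\<mu> (ix n) = val n" if "n \<in> G" for n
  proof -
    obtain \<sigma> where \<sigma>: "enc \<sigma> = the (g n)" using surj_enc by blast
    show ?thesis
      unfolding canon_h[OF that \<sigma>] measure_cyl_singleton val_def \<sigma>[symmetric] by simp
  qed
  have "(?\<mu> has_sum V) (ix ` G)"
    unfolding has_sum_reindex[OF inj_ix] o_def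
    by (subst has_sum_cong[OF \<mu>_ix]) (auto simp: V)
  then have "(?\<mu> has_sum V) UNIV"
    by (rule has_sum_cong_neutral[THEN iffD1, rotated -1]) (auto simp: h_0 canon_0 cyl_def)
  then have "?\<mu> sums V" by (rule has_sum_imp_sums)
  then have test: "schnorr_test h"
    using h_comp V_comp by (simp add: schnorr_test_def sums_iff)

  let ?I = "{n. K C (init_seg X n) \<le> enat (n + d)}"
  have "\<forall>n\<in>?I. \<exists>p. C p = Some (init_seg X n) \<and> length p \<le> n + d"
    by (auto elim: K_leE)
  then obtain p where p: "\<forall>n\<in>?I. C (p n) = Some (init_seg X n) \<and> length (p n) \<le> n + d"
    by (rule bchoice[THEN exE])
  have pG: "enc (p n) \<in> G" "the (g (enc (p n))) = enc (init_seg X n)" if "n \<in> ?I" for n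
    using bspec[OF p that] g(2)[of "p n"] by (auto simp: G_def D_def)
  have "inj_on (\<lambda>n. ix (enc (p n))) ?I"
  proof (rule inj_onI)
    fix m n assume mn: "m \<in> ?I" "n \<in> ?I" and "ix (enc (p m)) = ix (enc (p n))"
    then have "p m = p n" by (simp add: ix_def inj_enc inj_eq)
    then have "init_seg X m = init_seg X n" using bspec[OF p mn(1)] bspec[OF p mn(2)] by simp
    then show "m = n" by (metis length_init_seg)
  qed
  then have "infinite ((\<lambda>n. ix (enc (p n))) ` ?I)" using inf by (simp add: finite_image_iff)
  moreover have "(\<lambda>n. ix (enc (p n))) ` ?I \<subseteq> {m. X \<in> cyl (canon (h m))}"
  proof (rule image_subsetI)
    fix n assume n: "n \<in> ?I"
    show "ix (enc (p n)) \<in> {m. X \<in> cyl (canon (h m))}"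
      using canon_h[OF pG(1)[OF n] pG(2)[OF n, symmetric]] by (simp add: cyl_def)
  qed
  ultimately have "\<not> passes X h" unfolding passes_def using finite_subset by blast
  with test show ?thesis by blast
qed

section \<open>From Schnorr tests to machines\<close>

lemma schnorr_test_imp_machine:
  assumes test: "schnorr_test h" and fails: "\<not> passes X h"
  shows "\<exists>C d. computable_measure_machine C \<and> infinite {n. K C (init_seg X n) \<le> enat (n + d)}"
proof -
  let ?\<mu> = "\<lambda>m. measure cantor_measure (cyl (canon (h m)))"
  define S where "S = suminf ?\<mu>"
  have h: "rec_fn 1 (\<lambda>e. h (e 0))" and \<mu>_sums: "?\<mu> sums S" and S_comp: "computable_real S"
    using test by (auto simp: schnorr_test_def total_computable_iff S_def summable_sums)
  note rec_h = rec_fn_comp1[OF h]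
  have S0: "0 \<le> S" using \<mu>_sums by (metis S_def measure_nonneg suminf_nonneg sums_summable)
  obtain d :: nat where d: "S \<le> 2 ^ d"
    using real_arch_pow[of 2 S] by (auto intro: less_imp_le)

  \<comment> \<open>Since the lengths increase strictly, giving each string the leftmost free dyadic interval
    never leaves gaps, and no general Kraft--Chaitin argument is needed.\<close>
  define L where "L m = m + (\<Sum>j<Suc m. h j)" for m
  have L_mono: "L m < L n" if "m < n" for m n
  proof -
    have "(\<Sum>j<Suc m. h j) \<le> (\<Sum>j<Suc n. h j)" using that by (intro sum_mono2) auto
    then show ?thesis using that unfolding L_def by linarith
  qed
  have L_inj: "L m = L n \<longleftrightarrow> m = n" for m n using L_mono by (metis linorder_neq_iff less_irrefl)
  \<comment> \<open>The sum in \<open>L\<close> is there for this: membership in component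
    \<open>m\<close> is decided by \<open>L m\<close> bits. The summand \<open>m\<close> forces
    strict growth even where \<open>h\<close> vanishes.\<close>
  have h_le_L: "h m \<le> L m" for m by (simp add: L_def)
  define V where "V m = {v. v < 2 ^ L m \<and> extends_canon (h m) v}" for m
  have V_fin: "finite (V m)" for m by (simp add: V_def)
  have \<mu>_eq: "?\<mu> m = real (card (V m)) / 2 ^ L m" for m
    unfolding V_def by (rule measure_cyl_canon[OF h_le_L])
  define rank where "rank m v = (\<Sum>u<v. if extends_canon (h m) u then 1 else 0::nat)" for m v
  have rank_eq: "rank m v = card {u. u < v \<and> extends_canon (h m) u}" for m v
    by (simp add: rank_def sum.If_cases lessThan_def Collect_conj_eq)
  have card_V: "card (V m) = rank m (2 ^ L m)" for m by (simp add: rank_eq V_def)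
  have rank_less: "rank m u < rank m v" if "u < v" "extends_canon (h m) u" for m u v
    unfolding rank_eq using that by (intro psubset_card_mono) auto
  \<comment> \<open>The total measure of the components before \<open>m\<close>, in units of
    \<open>1 / 2 ^ L m\<close>. It is a whole number because \<open>L j \<le> L m\<close>, so block
    \<open>m\<close> starts on the grid of its own scale.\<close>
  define q where "q m = (\<Sum>j<m. rank j (2 ^ L j) * 2 ^ (L m - L j))" for m
  have q_eq: "real (q m) / 2 ^ L m = (\<Sum>j<m. ?\<mu> j)" for m
    unfolding q_def of_nat_sum sum_divide_distrib
  proof (rule sum.cong)
    fix j assume "j \<in> {..<m}"
    then have "L j \<le> L m" using L_mono[of j m] by simp
    then have "(2::real) ^ L m = 2 ^ (L m - L j) * 2 ^ L j" by (simp flip: power_add)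
    then show "real (rank j (2 ^ L j) * 2 ^ (L m - L j)) / 2 ^ L m = ?\<mu> j"
      by (simp add: \<mu>_eq card_V)
  qed simp
  have q_card: "real (q m + card (V m)) / 2 ^ L m = (\<Sum>j<Suc m. ?\<mu> j)" for m
    using q_eq[of m] by (simp add: add_divide_distrib \<mu>_eq)
  have q_bound: "q m + card (V m) \<le> 2 ^ (L m + d)" for m
  proof -
    have "(\<Sum>j<Suc m. ?\<mu> j) \<le> S"
      unfolding S_def using \<mu>_sums by (intro sum_le_suminf) (auto simp: sums_iff)
    then have "real (q m + card (V m)) / 2 ^ L m \<le> 2 ^ d" unfolding q_card using d by linarith
    then have "real (q m + card (V m)) \<le> real (2 ^ (L m + d))"
      by (simp add: divide_le_eq power_add mult.commute)
    then show ?thesis by (simp only: of_nat_le_iff)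
  qed
  have q_step: "(q m + card (V m)) * 2 ^ (L n - L m) \<le> q n" if "m < n" for m n
  proof -
    have "(\<Sum>j<Suc m. ?\<mu> j) \<le> (\<Sum>j<n. ?\<mu> j)" using that by (intro sum_mono2) auto
    then have "real (q m + card (V m)) / 2 ^ L m \<le> real (q n) / 2 ^ L n" unfolding q_card q_eq .
    then have "real (q m + card (V m)) / 2 ^ L m * 2 ^ L n \<le> real (q n) / 2 ^ L n * 2 ^ L n"
      by (rule mult_right_mono) simp
    moreover have "(2::real) ^ L n = 2 ^ (L n - L m) * 2 ^ L m"
      using L_mono[OF that] by (simp flip: power_add)
    then have "real (q m + card (V m)) / 2 ^ L m * 2 ^ L n = real ((q m + card (V m)) * 2 ^ (L n - L m))"
      by simp
    ultimately have "real ((q m + card (V m)) * 2 ^ (L n - L m)) \<le> real (q n)"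
      by simp
    then show ?thesis by (simp only: of_nat_le_iff)
  qed

  define Z where "Z = Sigma UNIV V"
  define pos where "pos z = q (fst z) + rank (fst z) (snd z)" for z
  \<comment> \<open>\<open>string_of\<close> lists the least significant bit first; reversal makes
    prefixes correspond to enclosing dyadic intervals.\<close>
  define code where "code z = rev (string_of (L (fst z) + d) (pos z))" for z
  have pos_less: "pos z < q (fst z) + card (V (fst z))" if "z \<in> Z" for z
    unfolding card_V using that rank_less[of "snd z" "2 ^ L (fst z)" "fst z"]
    by (auto simp: Z_def V_def pos_def)
  have length_code: "length (code z) = L (fst z) + d" for z by (simp add: code_def)
  have val_code: "bits_val (rev (code z)) = pos z" if "z \<in> Z" for z
    using pos_less[OF that] q_bound[of "fst z"] by (simp add: code_def bits_val_string_of)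
  have code_prefix: "z = z'" if "z \<in> Z" "z' \<in> Z" "prefix (code z) (code z')" for z z'
  proof -
    obtain m v n u where z: "z = (m, v)" "z' = (n, u)" by (metis surj_pair)
    have "L m \<le> L n" using prefix_length_le[OF that(3)] by (simp add: length_code z)
    then have "m \<le> n" using L_mono[of n m] by (meson leD leI)
    have div: "pos z' div 2 ^ (L n - L m) = pos z"
      using rev_val_prefix[OF that(3)] unfolding val_code[OF that(1)] val_code[OF that(2)] length_code
      by (simp add: z)
    \<comment> \<open>Being an extension would put \<open>z'\<close> inside the interval of
      \<open>z\<close>, but by \<open>q_step\<close> later components lie beyond the whole block of
      \<open>m\<close>.\<close>
    have "\<not> m < n"
    proof
      assume "m < n"
      have "(q m + card (V m)) * 2 ^ (L n - L m) \<le> pos z'"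
        using q_step[OF \<open>m < n\<close>] by (simp add: pos_def z)
      then have "q m + card (V m) \<le> pos z' div 2 ^ (L n - L m)"
        by (simp add: less_eq_div_iff_mult_less_eq)
      with div pos_less[OF that(1)] show False by (simp add: z)
    qed
    with \<open>m \<le> n\<close> have mn: "m = n" by simp
    with div have "rank m v = rank m u" by (simp add: pos_def z)
    moreover have "extends_canon (h m) v" "extends_canon (h m) u"
      using that mn by (auto simp: z Z_def V_def)
    ultimately have "v = u" using rank_less by (metis less_irrefl linorder_neq_iff)
    with mn show ?thesis by (simp add: z)
  qed
  then have inj_code: "inj_on code Z" by (auto intro!: inj_onI)

  define out where "out z = string_of (L (fst z)) (snd z)" for z
  define C where "C p = (if p \<in> code ` Z then Some (out (inv_into Z code p)) else None)" for p
  have C_code: "C (code z) = Some (out z)" if "z \<in> Z" for z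
    using that inj_code by (simp add: C_def)
  have dom_C: "dom C = code ` Z" by (auto simp: C_def dom_def)
  have pf: "prefix_free (dom C)" using code_prefix by (auto simp: dom_C prefix_free_def)

  have "((\<lambda>z. (1/2::real) ^ length (code z)) has_sum (S / 2 ^ d)) Z"
    unfolding Z_def
  proof (rule has_sum_SigmaI)
    show "((\<lambda>v. (1/2::real) ^ length (code (m, v))) has_sum (?\<mu> m / 2 ^ d)) (V m)" for m
    proof -
      have "((\<lambda>v. (1/2::real) ^ length (code (m, v))) has_sum (\<Sum>v\<in>V m. (1/2) ^ length (code (m, v)))) (V m)"
        by (rule has_sum_finite[OF V_fin])
      also have "(\<Sum>v\<in>V m. (1/2::real) ^ length (code (m, v))) = ?\<mu> m / 2 ^ d"
        by (simp add: length_code \<mu>_eq power_add power_one_over)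
      finally show ?thesis .
    qed
    have "(?\<mu> has_sum S) UNIV"
      using \<mu>_sums by (intro sums_nonneg_imp_has_sum) auto
    from has_sum_cmult_left[OF this, of "1 / 2 ^ d"]
    show "((\<lambda>m. ?\<mu> m / 2 ^ d) has_sum (S / 2 ^ d)) UNIV" by simp
    show "(\<lambda>z. (1/2::real) ^ length (code z)) summable_on Sigma UNIV V"
      using kraft_summable[OF pf] unfolding dom_C Z_def[symmetric] summable_on_reindex[OF inj_code]
      by (simp add: o_def)
  qed
  then have "((\<lambda>p. (1/2::real) ^ length p) has_sum (S / 2 ^ d)) (dom C)"
    unfolding dom_C has_sum_reindex[OF inj_code] by (simp add: o_def)
  then have meas: "domain_measure C = S / 2 ^ d"
    unfolding domain_measure_def by (rule infsumI)
  have comp_meas: "computable_real (domain_measure C)"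
  proof -
    obtain a where a: "rec_fn 1 (\<lambda>e. a (e 0))" "\<And>n. \<bar>S - real (a n) / 2 ^ n\<bar> \<le> 1 / 2 ^ n"
      using computable_real_nonneg[OF S0 S_comp] by blast
    show ?thesis
    proof (rule computable_realI[OF a(1)])
      show "rec_fn 1 (\<lambda>e. e 0 + d)" by (intro rec_intros) simp
      fix n
      have "domain_measure C - real (a n) / 2 ^ (n + d) = (S - real (a n) / 2 ^ n) / 2 ^ d"
        by (simp add: meas power_add diff_divide_distrib)
      then have "\<bar>domain_measure C - real (a n) / 2 ^ (n + d)\<bar> = \<bar>S - real (a n) / 2 ^ n\<bar> / 2 ^ d"
        by simp
      also have "\<dots> \<le> \<bar>S - real (a n) / 2 ^ n\<bar> / 1" by (intro divide_left_mono) auto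
      finally show "\<bar>domain_measure C - real (a n) / 2 ^ (n + d)\<bar> \<le> 1 / 2 ^ n"
        using a(2)[of n] by simp
    qed
  qed

  have rec_L: "rec_fn k F \<Longrightarrow> rec_fn k (\<lambda>e. L (F e))" for k F
    by (rule rec_fn_comp1[where f = L]) (unfold L_def, (intro rec_intros rec_h; simp))
  have rec_rank: "rec_fn k F \<Longrightarrow> rec_fn k G \<Longrightarrow> rec_fn k (\<lambda>e. rank (F e) (G e))" for k F G
    by (rule rec_fn_comp2[where f = rank])
      (unfold rank_def, (intro rec_intros dec_pred_extends_canon rec_h; simp))
  have rec_q: "rec_fn k F \<Longrightarrow> rec_fn k (\<lambda>e. q (F e))" for k F
    by (rule rec_fn_comp1[where f = q]) (unfold q_def, (intro rec_intros rec_rank rec_L; simp))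
  define is_code where "is_code c m v \<longleftrightarrow> extends_canon (h m) v \<and>
    code_length c = L m + d \<and> code_rev_val c = q m + rank m v" for c m v
  have is_code_iff: "v < 2 ^ L m \<and> is_code (enc p) m v \<longleftrightarrow> (m, v) \<in> Z \<and> p = code (m, v)" for p m v
  proof -
    have "p = code (m, v) \<longleftrightarrow> length p = L m + d \<and> bits_val (rev p) = pos (m, v)" if "(m, v) \<in> Z"
      using val_code[OF that] length_code[of "(m, v)"] bits_val_inj[of "rev p" "rev (code (m, v))"]
      by auto
    then show ?thesis by (auto simp: is_code_def code_rev_val_enc Z_def V_def pos_def)
  qed
  \<comment> \<open>The domain is decidable because \<open>m \<le> L m\<close>, which is at most the
    length of the description and hence at most its code \<open>c\<close>. In \<open>val_g\<close>,
    \<open>2 ^ L m + v - 1\<close> is the code of the string of length \<open>L m\<close> with value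
    \<open>v\<close>.\<close>
  define dom_g where "dom_g c \<longleftrightarrow> (\<exists>m<Suc c. \<exists>v<2 ^ L m. is_code c m v)" for c
  define val_g where "val_g c = (\<Sum>m<Suc c. \<Sum>v<2 ^ L m. if is_code c m v then 2 ^ L m + v - 1 else 0)" for c
  have index_le: "m < Suc (enc (code (m, v)))" for m v
  proof -
    have "m \<le> L m" by (simp add: L_def)
    also have "\<dots> \<le> enc (code (m, v))"
      using length_le_enc[of "code (m, v)"] by (simp add: length_code)
    finally show ?thesis by simp
  qed
  have dom_g: "dom_g (enc p) \<longleftrightarrow> p \<in> code ` Z" for p
  proof
    assume "dom_g (enc p)"
    then show "p \<in> code ` Z" using is_code_iff[of _ _ p] unfolding dom_g_def by blast
  next
    assume "p \<in> code ` Z"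
    then obtain m v where "(m, v) \<in> Z" "p = code (m, v)" by auto
    then show "dom_g (enc p)"
      using is_code_iff[of v m p] index_le[of m v] unfolding dom_g_def by blast
  qed
  have val_g: "val_g (enc (code z)) = enc (out z)" if "z \<in> Z" for z
  proof -
    obtain m v where z: "z = (m, v)" by (metis surj_pair)
    have uniq: "\<not> is_code (enc (code z)) k u" if "u < 2 ^ L k" "k \<noteq> m \<or> u \<noteq> v" for k u
    proof
      assume "is_code (enc (code z)) k u"
      then have "(k, u) \<in> Z" "code z = code (k, u)" using is_code_iff[of u k "code z"] that(1) by blast+
      then have "z = (k, u)" using inj_onD[OF inj_code] \<open>z \<in> Z\<close> by blast
      then show False using that(2) by (simp add: z)
    qed
    have mv: "v < 2 ^ L m" "is_code (enc (code z)) m v"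
      using is_code_iff[of v m "code z"] that by (auto simp: z)
    let ?f = "\<lambda>k u. if is_code (enc (code z)) k u then 2 ^ L k + u - 1 else 0"
    have "val_g (enc (code z)) = (\<Sum>u<2 ^ L m. ?f m u)"
      unfolding val_g_def
      by (rule sum_eq_single) (use index_le[of m v] uniq in \<open>auto simp: z intro!: sum.neutral\<close>)
    also have "\<dots> = ?f m v"
      by (rule sum_eq_single) (use mv uniq in auto)
    also have "\<dots> = enc (out z)"
      using Suc_enc_eq[of "out z"] mv by (simp add: out_def z bits_val_string_of)
    finally show ?thesis .
  qed
  have dec_is_code: "rec_fn k F \<Longrightarrow> rec_fn k G \<Longrightarrow> rec_fn k H \<Longrightarrow>
      dec_pred k (\<lambda>e. is_code (F e) (G e) (H e))" for k F G H
    unfolding is_code_def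
    by (intro rec_intros dec_pred_extends_canon rec_h rec_fn_code_length rec_fn_code_rev_val
        rec_L rec_q rec_rank)
  have "partial_computable (\<lambda>c. if dom_g c then Some (val_g c) else None)"
    unfolding dom_g_def val_g_def
    by (rule partial_computable_restrict; (intro rec_intros dec_is_code rec_L; simp))
  moreover have "(if dom_g (enc p) then Some (val_g (enc p)) else None) = map_option enc (C p)" for p
  proof (cases "p \<in> code ` Z")
    case True
    then obtain z where "z \<in> Z" "p = code z" by blast
    with True show ?thesis by (simp add: dom_g val_g C_code)
  qed (simp add: dom_g C_def)
  ultimately have "partial_computable_string_fun C"
    unfolding partial_computable_string_fun_def
    by (intro exI[of _ "\<lambda>c. if dom_g c then Some (val_g c) else None"]) blast
  with pf comp_meas have machine: "computable_measure_machine C"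
    by (simp add: computable_measure_machine_def)

  have "K C (init_seg X (L m)) \<le> enat (L m + d)" if X: "X \<in> cyl (canon (h m))" for m
  proof -
    let ?v = "bits_val (init_seg X (L m))"
    have z: "(m, ?v) \<in> Z"
      using X cyl_canon_iff[OF h_le_L] bits_val_less[of "init_seg X (L m)"] by (auto simp: Z_def V_def)
    have "out (m, ?v) = init_seg X (L m)"
      using string_of_bits_val[of "init_seg X (L m)"] by (simp add: out_def)
    with C_code[OF z] have "enat (length (code (m, ?v))) \<in>
        (\<lambda>p. enat (length p)) ` {p. C p = Some (init_seg X (L m))}" by auto
    then show ?thesis unfolding K_def by (metis Inf_lower fst_conv length_code)
  qed
  then have "L ` {m. X \<in> cyl (canon (h m))} \<subseteq> {n. K C (init_seg X n) \<le> enat (n + d)}" by blast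
  moreover have "infinite (L ` {m. X \<in> cyl (canon (h m))})"
    using fails L_inj by (simp add: passes_def finite_image_iff inj_on_def)
  ultimately have "infinite {n. K C (init_seg X n) \<le> enat (n + d)}" using finite_subset by blast
  with machine show ?thesis by blast
qed

theorem mainTheorem17:
  fixes X :: "nat \<Rightarrow> bool"
  shows "schnorr_random X \<longleftrightarrow>
    (\<forall>C. computable_measure_machine C \<longrightarrow>
       (\<forall>d::nat. \<exists>n0. \<forall>n\<ge>n0. K C (init_seg X n) > enat (n + d)))"
proof -
  \<comment> \<open>Finite sets of naturals are the bounded ones, so failure for some
    \<open>d\<close> means infinitely many violations, the form in which both directions are
    proved.\<close>
  have fin: "(\<exists>n0. \<forall>n\<ge>n0. K C (init_seg X n) > enat (n + d)) \<longleftrightarrow>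
      finite {n. K C (init_seg X n) \<le> enat (n + d)}" for C d
    unfolding finite_nat_set_iff_bounded by (auto simp: not_le[symmetric])
  show ?thesis
    unfolding fin schnorr_random_def
    using machine_imp_schnorr_test[of _ X] schnorr_test_imp_machine[of _ X] by blast
qed

end
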